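(* Let $G$ be a finite solvable group and let $K_1,\dots,K_n$ be (pairwise distinct) maximal subgroups of $G$. Set $H=\bigcap_{i=1}^n K_i$. Then there are vectors $\xi_1,\dots,\xi_n\in \ell_0(H)$ which are linearly independent and such that $\xi_i$ is $K_i$-invariant for each $1\le i\le n$. In particular, $n\le \dim \ell_0(H)^H<|H\backslash G/H|$.
   Context: For a subgroup $H$ of a finite group $G$, $\ell(H)=\ell(G,H)$ denotes the complex permutation module $\mathbb{C}_H^G$ of $G$ on the cosets $G/H$ (the trivial module of $H$ induced to $G$), and $\ell_0(H)\subset \ell(H)$ denotes the hyperplane of weight zero vectors, i.e. vectors whose coordinates in the permutation basis sum to $0$ (the $G$-stable complement to the $1$-dimensional $G$-fixed space of $\ell(H)$). $\ell_0(H)^H$ is the subspace of $H$-fixed vectors, and $|H\backslash G/H|$ is the number of $(H,H)$-double cosets in $G$. *)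

theory Defs
  imports
    Complex_Main
    "HOL-Algebra.Solvable_Groups"
    "HOL-Algebra.Left_Coset"
    "HOL-Library.Function_Algebras"
begin

text \<open>The complex vector space of all functions \<open>'b \<Rightarrow> complex\<close> with pointwise operations;
  notions of independence and dimension below refer to it, e.g. \<open>cfun.independent\<close>,
  \<open>cfun.dim\<close>.\<close>

definition cfun_scale :: "complex \<Rightarrow> ('b \<Rightarrow> complex) \<Rightarrow> 'b \<Rightarrow> complex"
  where "cfun_scale c f = (\<lambda>x. c * f x)"

global_interpretation cfun: vector_space "cfun_scale :: complex \<Rightarrow> ('b \<Rightarrow> complex) \<Rightarrow> 'b \<Rightarrow> complex"
  by unfold_locales (auto simp: cfun_scale_def algebra_simps)

definition maximal_subgroup :: "'a set \<Rightarrow> ('a, 'c) monoid_scheme \<Rightarrow> bool"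
  where "maximal_subgroup M G \<longleftrightarrow> subgroup M G \<and> M \<noteq> carrier G \<and>
    (\<forall>L. subgroup L G \<longrightarrow> M \<subseteq> L \<longrightarrow> L = M \<or> L = carrier G)"

definition double_cosets :: "('a, 'c) monoid_scheme \<Rightarrow> 'a set \<Rightarrow> 'a set set"
  where "double_cosets G H = (\<lambda>x. H <#>\<^bsub>G\<^esub> {x} <#>\<^bsub>G\<^esub> H) ` carrier G"

text \<open>A vector of the permutation module on \<open>G/H\<close> is given by its coordinates in the basis of
  left cosets, extended by \<open>0\<close> to all other sets.\<close>

definition perm_module :: "('a, 'c) monoid_scheme \<Rightarrow> 'a set \<Rightarrow> ('a set \<Rightarrow> complex) set"
  where "perm_module G H = {v. \<forall>C. C \<notin> lcosets\<^bsub>G\<^esub> H \<longrightarrow> v C = 0}"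

text \<open>The action of \<open>g\<close> sends the basis vector of a coset \<open>C\<close> to that of \<open>gC\<close>, so the coordinate
  of \<open>g \<cdot> v\<close> at \<open>C\<close> is the coordinate of \<open>v\<close> at \<open>g\<inverse>C\<close>; see \<open>perm_act_basis\<close> below.\<close>

definition perm_act ::
    "('a, 'c) monoid_scheme \<Rightarrow> 'a set \<Rightarrow> 'a \<Rightarrow> ('a set \<Rightarrow> complex) \<Rightarrow> 'a set \<Rightarrow> complex"
  where "perm_act G H g v = (\<lambda>C. if C \<in> lcosets\<^bsub>G\<^esub> H then v (inv\<^bsub>G\<^esub> g <#\<^bsub>G\<^esub> C) else 0)"

definition perm_module0 :: "('a, 'c) monoid_scheme \<Rightarrow> 'a set \<Rightarrow> ('a set \<Rightarrow> complex) set"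
  where "perm_module0 G H = {v \<in> perm_module G H. (\<Sum>C\<in>lcosets\<^bsub>G\<^esub> H. v C) = 0}"

definition invariant_under ::
    "('a, 'c) monoid_scheme \<Rightarrow> 'a set \<Rightarrow> 'a set \<Rightarrow> ('a set \<Rightarrow> complex) \<Rightarrow> bool"
  where "invariant_under G H K v \<longleftrightarrow> (\<forall>k\<in>K. perm_act G H k v = v)"

lemma (in group) perm_act_basis:
  assumes "subgroup H G" and "g \<in> carrier G" and "C \<in> lcosets H"
  shows "perm_act G H g (\<lambda>D. if D = C then 1 else 0) = (\<lambda>D. if D = g <# C then 1 else 0)"
proof -
  have H: "H \<subseteq> carrier G"
    using assms(1) by (rule subgroup.subset)
  have C: "C \<subseteq> carrier G"
    using assms(1) assms(3) subgroup.lcosets_carrier is_group by blast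
  have gC: "g <# C \<in> lcosets H"
  proof -
    obtain a where "a \<in> carrier G" "C = a <# H"
      using assms(3) unfolding LCOSETS_def by blast
    then have "g <# C = (g \<otimes> a) <# H" "g \<otimes> a \<in> carrier G"
      using assms(2) H by (simp_all add: lcos_m_assoc)
    then show ?thesis
      unfolding LCOSETS_def by blast
  qed
  have "D = g <# C" if "D \<in> lcosets H" "inv g <# D = C" for D
  proof -
    have "D \<subseteq> carrier G"
      using assms(1) that(1) subgroup.lcosets_carrier is_group by blast
    then have "g <# (inv g <# D) = D"
      using assms(2) by (simp add: lcos_m_assoc lcos_mult_one)
    then show ?thesis
      using that(2) by simp
  qed
  moreover have "inv g <# (g <# C) = C"
    using C assms(2) by (simp add: lcos_m_assoc lcos_mult_one)
  ultimately show ?thesis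
    using gC unfolding perm_act_def by (intro ext) metis
qed

end

theory Submission
  imports Defs "HOL-Algebra.Sylow" "HOL-Algebra.Multiplicative_Group" "HOL-Algebra.Zassenhaus"
    "HOL-Number_Theory.Cong"
begin

text \<open>The vectors are built from indicator functions of cosets \<open>tM\<close>, where \<open>M\<close> is one of the
  \<open>K\<^sub>j\<close> and \<open>tMt\<inverse> = K\<^sub>i\<close>: such a coset is left \<open>K\<^sub>i\<close>-invariant and right \<open>H\<close>-invariant. After
  subtracting the mean, the vectors of non-conjugate maximal subgroups \<open>K\<close>, \<open>M\<close> are orthogonal,
  because \<open>KM = G\<close> by a theorem of Ore. Within a conjugacy class, fix a base \<open>B\<close> and use cosets
  of \<open>B\<close> for all members but \<open>B\<close> itself, which gets a coset of another member if there is one. That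
  coset is not right \<open>B\<close>-invariant, unlike the others, so it cannot enter a linear relation. The
  others are pairwise disjoint and miss \<open>1\<close>, hence stay independent after subtracting the mean.\<close>

no_notation subset_mset (infix \<open><#\<close> 50)

subsection \<open>Conjugates and core-free maximal subgroups\<close>

text \<open>The weight-zero condition is the obstacle. If a class consists of all conjugates of a
  non-normal maximal \<open>B\<close>, the indicators of the cosets \<open>tB\<close>, one for each
  conjugate, sum to the constant \<open>1\<close>, so they become dependent once the means are
  removed; the three subgroups of order 2 in \<open>S_3\<close> already show this. Hence the
  exceptional coset reserved for the base. Each coset is one of a member \<open>K j\<close>, not of
  an arbitrary conjugate: the inclusion \<open>H \<subseteq> K j\<close> makes
  \<open>t <# K j\<close> a union of left cosets of \<open>H\<close>, so that its indicator lives on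
  \<open>G/H\<close>. The linear algebra is therefore done with functions on \<open>G\<close>, whose
  value at \<open>x\<close> becomes the coordinate at \<open>x <# H\<close>. Solvability enters only
  through Ore's theorem. A factorization \<open>KM = G\<close> makes every coset of \<open>K\<close>
  meet every coset of \<open>M\<close> in \<open>|K||M|/|G|\<close> points, which is what makes the
  centred indicators uncorrelated. The strict upper bound for the dimension comes from the constant
  vector: it is \<open>H\<close>-invariant, but its weight \<open>|G:H|\<close> is not zero.\<close>

text \<open>This is \<open>g K g\<inverse>\<close>, written as a preimage so that membership unfolds
  without a witness.\<close>

definition conj_set :: "('a, 'c) monoid_scheme \<Rightarrow> 'a \<Rightarrow> 'a set \<Rightarrow> 'a set"
  where "conj_set G g K = {x \<in> carrier G. inv\<^bsub>G\<^esub> g \<otimes>\<^bsub>G\<^esub> x \<otimes>\<^bsub>G\<^esub> g \<in> K}"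

definition core_free :: "('a, 'c) monoid_scheme \<Rightarrow> 'a set \<Rightarrow> bool"
  where "core_free G K \<longleftrightarrow> (\<forall>N. N \<lhd> G \<longrightarrow> N \<subseteq> K \<longrightarrow> N = {\<one>\<^bsub>G\<^esub>})"

context group
begin

lemma inv_cancel_left [simp]:
  assumes "x \<in> carrier G" "y \<in> carrier G"
  shows "x \<otimes> (inv x \<otimes> y) = y" "inv x \<otimes> (x \<otimes> y) = y"
  using assms by (metis inv_closed l_inv l_one m_assoc r_inv)+

text \<open>Right-associating and pushing inverses inwards brings both sides of a conjugation
  identity to a form that \<open>inv_cancel_left\<close> finishes.\<close>

lemmas group_word = m_assoc inv_mult_group

lemma subgroup_conj_set:
  assumes "subgroup K G" "g \<in> carrier G"
  shows "subgroup (conj_set G g K) G"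
proof -
  interpret K: subgroup K G by fact
  show ?thesis
  proof (rule subgroupI)
    show "conj_set G g K \<subseteq> carrier G" "conj_set G g K \<noteq> {}"
      using assms K.one_closed by (auto simp: conj_set_def intro!: exI[of _ \<one>])
  next
    fix a assume "a \<in> conj_set G g K"
    then have a: "a \<in> carrier G" "inv g \<otimes> a \<otimes> g \<in> K" by (auto simp: conj_set_def)
    have "inv (inv g \<otimes> a \<otimes> g) = inv g \<otimes> inv a \<otimes> g"
      using a assms by (simp add: group_word)
    then show "inv a \<in> conj_set G g K"
      using a K.m_inv_closed[OF a(2)] by (simp add: conj_set_def)
  next
    fix a b assume "a \<in> conj_set G g K" "b \<in> conj_set G g K"
    then have ab: "a \<in> carrier G" "inv g \<otimes> a \<otimes> g \<in> K" "b \<in> carrier G" "inv g \<otimes> b \<otimes> g \<in> K"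
      by (auto simp: conj_set_def)
    have "(inv g \<otimes> a \<otimes> g) \<otimes> (inv g \<otimes> b \<otimes> g) = inv g \<otimes> (a \<otimes> b) \<otimes> g"
      using ab assms by (simp add: group_word)
    then show "a \<otimes> b \<in> conj_set G g K"
      using ab K.m_closed[OF ab(2,4)] by (simp add: conj_set_def)
  qed
qed

lemma conj_set_inv:
  assumes "K \<subseteq> carrier G" "g \<in> carrier G"
  shows "conj_set G (inv g) (conj_set G g K) = K"
proof -
  have "inv g \<otimes> (inv (inv g) \<otimes> x \<otimes> inv g) \<otimes> g = x" if "x \<in> carrier G" for x
    using that assms by (simp add: group_word)
  then show ?thesis
    using assms by (auto simp: conj_set_def simp del: inv_inv)
qed

lemma conj_set_inv':
  assumes "K \<subseteq> carrier G" "g \<in> carrier G"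
  shows "conj_set G g (conj_set G (inv g) K) = K"
  using conj_set_inv[OF assms(1), of "inv g"] assms(2) by (metis inv_closed inv_inv)

lemma conj_set_mult:
  assumes "g \<in> carrier G" "h \<in> carrier G"
  shows "conj_set G g (conj_set G h K) = conj_set G (g \<otimes> h) K"
  using assms by (auto simp: conj_set_def group_word)

lemma conj_set_one: "K \<subseteq> carrier G \<Longrightarrow> conj_set G \<one> K = K"
  by (auto simp: conj_set_def)

lemma conj_set_carrier: "g \<in> carrier G \<Longrightarrow> conj_set G g (carrier G) = carrier G"
  by (auto simp: conj_set_def)

lemma conj_set_mono: "K \<subseteq> L \<Longrightarrow> conj_set G g K \<subseteq> conj_set G g L"
  by (auto simp: conj_set_def)

lemma conj_set_normal:
  assumes "N \<lhd> G" "g \<in> carrier G"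
  shows "conj_set G g N = N"
proof -
  interpret N: normal N G by fact
  have "x \<in> N" if "x \<in> carrier G" "inv g \<otimes> x \<otimes> g \<in> N" for x
  proof -
    have "g \<otimes> (inv g \<otimes> x \<otimes> g) \<otimes> inv g = x"
      using that(1) assms(2) by (simp add: group_word)
    then show ?thesis
      using N.inv_op_closed2[OF assms(2) that(2)] by simp
  qed
  moreover have "inv g \<otimes> x \<otimes> g \<in> N" if "x \<in> N" for x
    using N.inv_op_closed1[OF assms(2) that] .
  ultimately show ?thesis
    unfolding conj_set_def using N.mem_carrier by blast
qed

lemma maximal_subgroup_conj_set:
  assumes M: "maximal_subgroup M G" and g: "g \<in> carrier G"
  shows "maximal_subgroup (conj_set G g M) G"
proof -
  have sub: "M \<subseteq> carrier G" using M by (auto simp: maximal_subgroup_def dest: subgroup.subset)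
  have *: "L = conj_set G g M \<or> L = carrier G" if L: "subgroup L G" "conj_set G g M \<subseteq> L" for L
  proof -
    have "M \<subseteq> conj_set G (inv g) L"
      using conj_set_mono[OF L(2), of "inv g"] conj_set_inv[OF sub g] by simp
    then have "conj_set G (inv g) L = M \<or> conj_set G (inv g) L = carrier G"
      using M subgroup_conj_set[OF L(1), of "inv g"] g by (auto simp: maximal_subgroup_def)
    then show ?thesis
      using conj_set_inv'[OF subgroup.subset[OF L(1)] g] conj_set_carrier[OF g] by auto
  qed
  have "conj_set G g M \<noteq> carrier G"
    using conj_set_inv[OF sub g] conj_set_carrier[of "inv g"] g M by (auto simp: maximal_subgroup_def)
  then show ?thesis
    using * subgroup_conj_set M g by (auto simp: maximal_subgroup_def)
qed

lemma core_free_conj_set: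
  assumes "core_free G M" "M \<subseteq> carrier G" "g \<in> carrier G"
  shows "core_free G (conj_set G g M)"
  unfolding core_free_def
proof (intro allI impI)
  fix N assume N: "N \<lhd> G" "N \<subseteq> conj_set G g M"
  have "conj_set G (inv g) N \<subseteq> M"
    using conj_set_mono[OF N(2), of "inv g"] conj_set_inv[OF assms(2,3)] by simp
  then show "N = {\<one>}"
    using conj_set_normal[OF N(1), of "inv g"] assms N(1) by (simp add: core_free_def)
qed

lemma set_mult_iff: "x \<in> H <#> K \<longleftrightarrow> (\<exists>h\<in>H. \<exists>k\<in>K. x = h \<otimes> k)"
  unfolding set_mult_def by blast

lemma subset_set_mult:
  assumes "subgroup N G" "subgroup M G"
  shows "N \<subseteq> N <#> M" "M \<subseteq> N <#> M"
  unfolding set_mult_iff subset_iff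
  using assms by (metis r_one l_one subgroup.one_closed subgroup.mem_carrier)+

lemma set_mult_maximal:
  assumes "maximal_subgroup M G" "N \<lhd> G" "\<not> N \<subseteq> M"
  shows "N <#> M = carrier G"
proof -
  interpret N: normal N G by fact
  interpret M: subgroup M G using assms by (auto simp: maximal_subgroup_def)
  have sub: "subgroup (N <#> M) G"
    using mult_norm_subgroup[OF assms(2) M.subgroup_axioms] .
  have "M \<subseteq> N <#> M" "N \<subseteq> N <#> M"
    using subset_set_mult[OF N.subgroup_axioms M.subgroup_axioms] by auto
  then show ?thesis
    using assms sub unfolding maximal_subgroup_def by metis
qed

text \<open>The normaliser of \<open>A\<close> contains \<open>K\<close> and \<open>M\<close>. It is
  proper, since otherwise \<open>A\<close> would be a nontrivial normal subgroup of \<open>G\<close>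
  inside the core-free \<open>K\<close>; by maximality it equals both.\<close>

lemma maximal_eq_if_normalise:
  assumes K: "maximal_subgroup K G" "core_free G K" and M: "maximal_subgroup M G"
    and A: "subgroup A G" "A \<noteq> {\<one>}" "A \<subseteq> K"
    and KA: "\<And>k a. k \<in> K \<Longrightarrow> a \<in> A \<Longrightarrow> k \<otimes> a \<otimes> inv k \<in> A"
    and MA: "\<And>m a. m \<in> M \<Longrightarrow> a \<in> A \<Longrightarrow> m \<otimes> a \<otimes> inv m \<in> A"
  shows "K = M"
proof -
  interpret A: subgroup A G by fact
  \<comment> \<open>The normaliser of \<open>A\<close>. Asking for conjugation in both directions
    makes closure under inverses immediate.\<close>
  define S where "S = {x \<in> carrier G. \<forall>a\<in>A. x \<otimes> a \<otimes> inv x \<in> A \<and> inv x \<otimes> a \<otimes> x \<in> A}"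
  have S: "subgroup S G"
  proof (rule subgroupI)
    show "S \<subseteq> carrier G" "S \<noteq> {}"
      by (auto simp: S_def intro!: exI[of _ \<one>])
  next
    fix x assume "x \<in> S" then show "inv x \<in> S" by (auto simp: S_def)
  next
    fix x y assume xy: "x \<in> S" "y \<in> S"
    have "x \<otimes> y \<otimes> a \<otimes> inv (x \<otimes> y) \<in> A \<and> inv (x \<otimes> y) \<otimes> a \<otimes> (x \<otimes> y) \<in> A" if a: "a \<in> A" for a
    proof -
      have "x \<otimes> y \<otimes> a \<otimes> inv (x \<otimes> y) = x \<otimes> (y \<otimes> a \<otimes> inv y) \<otimes> inv x"
        "inv (x \<otimes> y) \<otimes> a \<otimes> (x \<otimes> y) = inv y \<otimes> (inv x \<otimes> a \<otimes> x) \<otimes> y"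
        using xy a by (auto simp: S_def group_word)
      then show ?thesis using xy a by (simp add: S_def)
    qed
    then show "x \<otimes> y \<in> S" using xy by (simp add: S_def)
  qed
  have incl: "L \<subseteq> S" if "subgroup L G" "\<And>k a. k \<in> L \<Longrightarrow> a \<in> A \<Longrightarrow> k \<otimes> a \<otimes> inv k \<in> A" for L
  proof
    fix k assume "k \<in> L"
    then have "k \<in> carrier G" "inv k \<in> L" using that(1) by (auto simp: subgroup.m_inv_closed dest: subgroup.mem_carrier)
    then show "k \<in> S" using that(2)[of k] that(2)[of "inv k"] \<open>k \<in> L\<close> by (auto simp: S_def)
  qed
  have "S \<noteq> carrier G"
  proof
    assume "S = carrier G"
    then have "A \<lhd> G" using A(1) by (auto simp: S_def normal_inv_iff)
    then show False using K(2) A by (auto simp: core_free_def)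
  qed
  moreover have "K \<subseteq> S" "M \<subseteq> S"
    using K(1) M incl[OF _ KA] incl[OF _ MA] unfolding maximal_subgroup_def by blast+
  ultimately show ?thesis
    using K M S by (metis maximal_subgroup_def)
qed

text \<open>Core-freeness keeps \<open>N\<close> out of \<open>K\<close>, so maximality gives the
  product. In \<open>g = nk\<close> the factor \<open>k\<close> preserves
  \<open>N \<inter> K\<close> under conjugation and \<open>n\<close> centralises it,
  \<open>N\<close> being abelian; so \<open>N \<inter> K\<close> is normal in \<open>G\<close> and
  lies in \<open>K\<close>.\<close>

lemma core_free_complement:
  assumes K: "maximal_subgroup K G" "core_free G K"
    and N: "N \<lhd> G" "N \<noteq> {\<one>}" "\<And>x y. x \<in> N \<Longrightarrow> y \<in> N \<Longrightarrow> x \<otimes> y = y \<otimes> x"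
  shows "N <#> K = carrier G" "N \<inter> K = {\<one>}"
proof -
  interpret N: normal N G by fact
  interpret K: subgroup K G using K by (auto simp: maximal_subgroup_def)
  show NK: "N <#> K = carrier G"
    using set_mult_maximal[OF K(1) N(1)] K(2) N by (auto simp: core_free_def)
  have "N \<inter> K \<lhd> G"
    unfolding normal_inv_iff
  proof (intro conjI ballI)
    show "subgroup (N \<inter> K) G" by (intro subgroups_Inter_pair N.subgroup_axioms K.subgroup_axioms)
    fix g x assume g: "g \<in> carrier G" and x: "x \<in> N \<inter> K"
    obtain n k where nk: "n \<in> N" "k \<in> K" "g = n \<otimes> k"
      using g NK set_mult_iff by metis
    have kx: "k \<otimes> x \<otimes> inv k \<in> N" using nk x by (auto intro: N.inv_op_closed2)
    have "g \<otimes> x \<otimes> inv g = n \<otimes> (k \<otimes> x \<otimes> inv k) \<otimes> inv n"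
      using nk x by (auto simp: group_word)
    also have "\<dots> = (k \<otimes> x \<otimes> inv k) \<otimes> n \<otimes> inv n"
      using N(3)[OF nk(1) kx] by simp
    also have "\<dots> = k \<otimes> x \<otimes> inv k"
      using nk x by (auto simp: group_word)
    finally show "g \<otimes> x \<otimes> inv g \<in> N \<inter> K" using kx nk x by simp
  qed
  then show "N \<inter> K = {\<one>}" using K(2) by (auto simp: core_free_def)
qed

text \<open>\<open>R\<close> also supplements \<open>K\<close>, so Dedekind's law gives
  \<open>N = R(N \<inter> K) = R\<close>. Thus an abelian normal subgroup is automatically a minimal
  one here.\<close>

lemma core_free_minimal:
  assumes K: "maximal_subgroup K G" "core_free G K"
    and N: "N \<lhd> G" "N \<noteq> {\<one>}" "\<And>x y. x \<in> N \<Longrightarrow> y \<in> N \<Longrightarrow> x \<otimes> y = y \<otimes> x"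
    and R: "R \<lhd> G" "R \<subseteq> N" "R \<noteq> {\<one>}"
  shows "R = N"
proof -
  interpret N: normal N G by fact
  interpret R: normal R G by fact
  interpret K: subgroup K G using K by (auto simp: maximal_subgroup_def)
  have "R <#> K = carrier G"
    using core_free_complement(1)[OF K R(1,3)] N(3) R(2) by blast
  have "n \<in> R" if n: "n \<in> N" for n
  proof -
    obtain r k where rk: "r \<in> R" "k \<in> K" "n = r \<otimes> k"
      using n \<open>R <#> K = carrier G\<close> N.mem_carrier set_mult_iff by metis
    have "k = inv r \<otimes> n" using rk by simp
    then have "k \<in> N" using rk(1) R(2) n by (metis N.m_closed N.m_inv_closed subsetD)
    then have "k = \<one>" using rk(2) core_free_complement(2)[OF K N] by blast
    then show ?thesis using rk(1,3) by simp
  qed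
  then show ?thesis using R by blast
qed

end

subsection \<open>Fixed points of groups of prime power order\<close>

text \<open>Orbit lengths divide \<open>q ^ a\<close>, so every orbit that is not a single point has
  length divisible by \<open>q\<close>.\<close>

lemma (in group_action) card_fixed_points_cong:
  assumes fin: "finite E" and q: "prime q" and ord: "order G = q ^ a"
  shows "[card {x \<in> E. \<forall>g\<in>carrier G. \<phi> g x = x} = card E] (mod q)"
proof -
  interpret group_hom G "BijGroup E" \<phi> by (rule group_hom)
  define F where "F = {x \<in> E. \<forall>g\<in>carrier G. \<phi> g x = x}"
  have orbit_F: "orbit G \<phi> x = {x}" if "x \<in> F" for x
  proof -
    have "orbit G \<phi> x = (\<lambda>g. \<phi> g x) ` carrier G"
      unfolding orbit_def by blast
    also have "\<dots> = (\<lambda>_. x) ` carrier G"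
      by (rule image_cong) (use that in \<open>auto simp: F_def\<close>)
    also have "\<dots> = {x}"
      using G.one_closed by blast
    finally show ?thesis .
  qed
  have dvd: "q dvd card (orbit G \<phi> x)" if x: "x \<in> E - F" for x
  proof -
    have "card (orbit G \<phi> x) dvd q ^ a"
      using orbit_stabilizer_theorem[of x] x ord by (metis DiffD1 dvd_triv_left)
    then obtain i where i: "card (orbit G \<phi> x) = q ^ i"
      using q by (auto simp: divides_primepow_nat)
    have "i \<noteq> 0"
    proof
      assume "i = 0"
      then obtain y where y: "orbit G \<phi> x = {y}"
        using i by (auto simp: card_1_singleton_iff)
      moreover have "x \<in> orbit G \<phi> x"
        using orbit_refl x by blast
      ultimately have "\<phi> g x = x" if "g \<in> carrier G" for g
        using that by (auto simp: orbit_def)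
      then show False using x by (auto simp: F_def)
    qed
    then show ?thesis using i by simp
  qed
  define Os where "Os = orbits G E \<phi>"
  define S where "S = (\<lambda>x. {x}) ` F"
  have finO: "finite Os"
    using fin by (simp add: Os_def orbits_def setcompr_eq_image)
  have S: "S \<subseteq> Os"
  proof
    fix orb assume "orb \<in> S"
    then obtain x where "x \<in> F" "orb = {x}" by (auto simp: S_def)
    then have "x \<in> E" "orb = orbit G \<phi> x" using orbit_F by (auto simp: F_def)
    then show "orb \<in> Os" unfolding Os_def orbits_def by blast
  qed
  have "card E = (\<Sum>orb\<in>Os. card orb)"
    using disjoint_sum[OF fin, of "\<lambda>_. 1 :: nat"] by (simp add: Os_def)
  also have "\<dots> = (\<Sum>orb\<in>S. card orb) + (\<Sum>orb\<in>Os - S. card orb)"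
    using sum.subset_diff[OF S finO] by (simp add: add.commute)
  also have "(\<Sum>orb\<in>S. card orb) = card F"
    by (simp add: S_def sum.reindex)
  finally have "card E = card F + (\<Sum>orb\<in>Os - S. card orb)" .
  moreover have "q dvd (\<Sum>orb\<in>Os - S. card orb)"
  proof (rule dvd_sum)
    fix orb assume "orb \<in> Os - S"
    then obtain x where x: "x \<in> E" "orb = orbit G \<phi> x" "orb \<notin> S"
      by (auto simp: Os_def orbits_def)
    then have "x \<notin> F" using orbit_F by (auto simp: S_def)
    then show "q dvd card orb" using dvd x by blast
  qed
  ultimately show ?thesis
    unfolding F_def[symmetric] by (elim dvdE) (simp add: cong_def)
qed

context group
begin

lemma subgroup_action_fixed_points_cong:
  assumes P: "subgroup P G" "card P = q ^ a" "prime q" and fin: "finite E"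
    and closed: "\<And>p x. p \<in> P \<Longrightarrow> x \<in> E \<Longrightarrow> f p x \<in> E"
    and one: "\<And>x. x \<in> E \<Longrightarrow> f \<one> x = x"
    and mult: "\<And>p r x. p \<in> P \<Longrightarrow> r \<in> P \<Longrightarrow> x \<in> E \<Longrightarrow> f (p \<otimes> r) x = f p (f r x)"
  shows "[card {x \<in> E. \<forall>p\<in>P. f p x = x} = card E] (mod q)"
proof -
  interpret P: subgroup P G by fact
  let ?P = "G\<lparr>carrier := P\<rparr>"
  have bij: "bij_betw (f p) E E" if p: "p \<in> P" for p
  proof (rule bij_betwI[where g = "f (inv p)"])
    have p': "inv p \<in> P" "inv p \<otimes> p = \<one>" "p \<otimes> inv p = \<one>"
      using p by auto
    show "f p \<in> E \<rightarrow> E" "f (inv p) \<in> E \<rightarrow> E"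
      using closed[OF p] closed[OF p'(1)] by blast+
    show "f (inv p) (f p x) = x" "f p (f (inv p) x) = x" if "x \<in> E" for x
      using mult[OF p'(1) p that] mult[OF p p'(1) that] one[OF that] p' by simp_all
  qed
  \<comment> \<open>Elements of \<open>Bij E\<close> are extensional, so the plain function
    \<open>f p\<close> has to be cut off outside \<open>E\<close> before it can be an element of
    \<open>BijGroup E\<close>.\<close>
  have B: "restrict (f p) E \<in> Bij E" if "p \<in> P" for p
    using bij[OF that] by (simp add: Bij_def)
  have "group_action ?P E (\<lambda>p. restrict (f p) E)"
    unfolding group_action_def group_hom_def group_hom_axioms_def hom_def
  proof (intro conjI CollectI ballI Pi_I)
    show "group ?P" by (rule subgroup_imp_group[OF P(1)])
    show "group (BijGroup E)" by (rule group_BijGroup)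
  next
    fix p assume "p \<in> carrier ?P"
    then show "restrict (f p) E \<in> carrier (BijGroup E)"
      using B by (simp add: BijGroup_def)
  next
    fix p r assume "p \<in> carrier ?P" "r \<in> carrier ?P"
    then have pr: "p \<in> P" "r \<in> P" by simp_all
    have "restrict (f (p \<otimes> r)) E = compose E (restrict (f p) E) (restrict (f r) E)"
    proof
      fix x show "restrict (f (p \<otimes> r)) E x = compose E (restrict (f p) E) (restrict (f r) E) x"
        using mult[OF pr, of x] closed[OF pr(2), of x] by (cases "x \<in> E") (simp_all add: compose_def)
    qed
    then show "restrict (f (p \<otimes>\<^bsub>?P\<^esub> r)) E = restrict (f p) E \<otimes>\<^bsub>BijGroup E\<^esub> restrict (f r) E"
      using B[OF pr(1)] B[OF pr(2)] by (simp add: BijGroup_def)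
  qed
  from group_action.card_fixed_points_cong[OF this fin P(3), of a] show ?thesis
    using P(2) by (simp add: order_def cong: conj_cong)
qed

end

subsection \<open>Normal subgroups of solvable groups\<close>

text \<open>The description by element orders shows that \<open>P\<close> is stable under every
  automorphism, which is what \<open>solvable_primary_normal\<close> needs. For the harder
  inclusion, \<open>x [^] m\<close> lies in \<open>P\<close> because \<open>m\<close> is the index,
  and \<open>m\<close> is coprime to \<open>q ^ a\<close>.\<close>

lemma (in comm_group) sylow_eq_torsion:
  assumes fin: "finite (carrier G)" and q: "prime q" "order G = q ^ a * m" "\<not> q dvd m"
    and P: "subgroup P G" "card P = q ^ a"
  shows "P = {x \<in> carrier G. x [^] (q ^ a) = \<one>}"
proof -
  interpret P: normal P G by (rule subgroup_imp_normal[OF P(1)])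
  have "m \<noteq> 0" using q by (metis dvd_0_right)
  have "x [^] (q ^ a) = \<one>" if "x \<in> P" for x
    using group.pow_order_eq_1[OF subgroup_imp_group[OF P(1)], of x] that P(2)
    by (simp add: order_def flip: nat_pow_consistent)
  moreover have "x \<in> P" if x: "x \<in> carrier G" "x [^] (q ^ a) = \<one>" for x
  proof -
    interpret Q: group "G Mod P" by (rule P.factorgroup_is_group)
    have "card (rcosets P) * q ^ a = q ^ a * m"
      using lagrange[OF P(1)] P(2) q(2) by simp
    then have "order (G Mod P) = m"
      using q(1) by (auto simp: order_def FactGroup_def prime_gt_0_nat \<open>m \<noteq> 0\<close>)
    then have "(P #> x) [^]\<^bsub>G Mod P\<^esub> m = P"
      using Q.pow_order_eq_1[of "P #> x"] x(1) by (simp add: carrier_FactGroup)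
    then have "P #> (x [^] m) = P"
      using P.FactGroup_pow[OF x(1)] by simp
    then have xm: "x [^] m \<in> P"
      using rcos_self[OF nat_pow_closed[OF x(1)] P(1)] by metis
    have "coprime m (q ^ a)"
      using q(1,3) by (metis coprime_commute coprime_power_left_iff prime_imp_coprime)
    \<comment> \<open>Bezout in natural numbers: the surplus \<open>q ^ a * v\<close> in the
      exponent costs nothing, as \<open>x [^] (q ^ a) = \<one>\<close>.\<close>
    then obtain u v where uv: "m * u = q ^ a * v + 1"
      using bezout_nat[OF \<open>m \<noteq> 0\<close>, of "q ^ a"] by (auto simp: coprime_iff_gcd_eq_1)
    have "x = (x [^] (q ^ a)) [^] v \<otimes> x"
      using x by simp
    also have "\<dots> = x [^] (q ^ a * v + 1)"
      using x(1) by (simp add: nat_pow_pow)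
    also have "\<dots> = x [^] (m * u)"
      by (simp only: uv)
    also have "\<dots> = (x [^] m) [^] u"
      using x(1) by (simp add: nat_pow_pow)
    finally have "x = (x [^] m) [^] u" .
    moreover have "y [^] i \<in> P" if "y \<in> P" for y and i :: nat
      using that by (induction i) auto
    ultimately show ?thesis
      using xm by metis
  qed
  ultimately show ?thesis by auto
qed

context group
begin

lemma commutator_in_derived:
  assumes "x \<in> H" "y \<in> H"
  shows "x \<otimes> y \<otimes> inv x \<otimes> inv y \<in> derived G H"
  unfolding derived_def by (intro generate.incl UN_I[OF assms(1)] UN_I[OF assms(2)]) simp

text \<open>The witness is the last nontrivial term of the derived series of \<open>H\<close>: its
  commutators lie in the next term, which is trivial, and all terms are normal in
  \<open>H\<close>.\<close>

lemma solvable_abelian_normal: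
  assumes H: "subgroup H G" "solvable_seq G H" "H \<noteq> {\<one>}"
  obtains A where "subgroup A G" "A \<subseteq> H" "A \<noteq> {\<one>}"
    and "\<forall>x\<in>A. \<forall>y\<in>A. x \<otimes> y = y \<otimes> x" "\<forall>h\<in>H. \<forall>x\<in>A. h \<otimes> x \<otimes> inv h \<in> A"
proof -
  let ?D = "\<lambda>n. (derived G ^^ n) H"
  have sub: "subgroup (?D n) G" for n
    by (rule exp_of_derived_is_subgroup[OF H(1)])
  obtain k where "?D k = {\<one>}"
    using solvable_imp_trivial_derived_seq[OF H(2)] by blast
  then obtain n where n: "?D n \<noteq> {\<one>}" "?D (Suc n) = {\<one>}"
    using H(3) by (induction k) auto
  let ?H = "G\<lparr>carrier := H\<rparr>"
  interpret H: group ?H by (rule subgroup_imp_group[OF H(1)])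
  have "?D i \<subseteq> H \<and> ?D i \<lhd> ?H" for i
  proof (induction i)
    case 0
    show ?case using H.normal_self by simp
  next
    case (Suc i)
    then have "derived ?H (?D i) = derived G (?D i)"
      using derived_consistent[OF _ H(1)] by blast
    moreover have "derived G (?D i) \<subseteq> H"
      using derived_incl[OF _ H(1)] Suc by blast
    ultimately show ?case
      using H.derived_is_normal[of "?D i"] Suc by simp
  qed
  then have incl: "?D n \<subseteq> H" and nor: "?D n \<lhd> ?H" by auto
  show ?thesis
  proof (rule that[OF sub incl n(1)]; intro ballI)
    fix x y assume xy: "x \<in> ?D n" "y \<in> ?D n"
    then have c: "x \<in> carrier G" "y \<in> carrier G"
      using subgroup.mem_carrier[OF sub] by blast+
    have "x \<otimes> y \<otimes> inv x \<otimes> inv y \<in> derived G (?D n)"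
      using commutator_in_derived[OF xy] .
    then have "x \<otimes> y \<otimes> inv x \<otimes> inv y = \<one>" using n(2) by simp
    then have "x \<otimes> y \<otimes> inv (y \<otimes> x) = \<one>"
      using c by (simp add: inv_mult_group m_assoc)
    then show "x \<otimes> y = y \<otimes> x"
      using c by (metis inv_closed inv_equality inv_inv m_closed)
  next
    fix h x assume hx: "h \<in> H" "x \<in> ?D n"
    then show "h \<otimes> x \<otimes> inv h \<in> ?D n"
      using normal.inv_op_closed2[OF nor, of h x] by (simp add: m_inv_consistent[OF H(1)])
  qed
qed

text \<open>A Sylow subgroup of the abelian group from \<open>solvable_abelian_normal\<close>
  consists of all its elements killed by \<open>q ^ a\<close>, so conjugation by \<open>H\<close>
  preserves it.\<close>

lemma solvable_primary_normal:
  assumes H: "subgroup H G" "solvable_seq G H" "H \<noteq> {\<one>}" and fin: "finite (carrier G)"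
  obtains P q a where "prime (q :: nat)" "card P = q ^ a" "subgroup P G" "P \<subseteq> H" "P \<noteq> {\<one>}"
    and "\<forall>h\<in>H. \<forall>x\<in>P. h \<otimes> x \<otimes> inv h \<in> P"
proof -
  obtain A where A: "subgroup A G" "A \<subseteq> H" "A \<noteq> {\<one>}"
    and comm: "\<forall>x\<in>A. \<forall>y\<in>A. x \<otimes> y = y \<otimes> x"
    and nor: "\<forall>h\<in>H. \<forall>x\<in>A. h \<otimes> x \<otimes> inv h \<in> A"
    by (rule solvable_abelian_normal[OF H])
  let ?A = "G\<lparr>carrier := A\<rparr>"
  interpret A: subgroup A G by (rule A(1))
  interpret CA: comm_group ?A
    by (rule group.group_comm_groupI[OF subgroup_imp_group[OF A(1)]]) (simp add: comm)
  have finA: "finite A" using A.subset fin finite_subset by blast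
  have "card A \<noteq> 1"
    using A(3) A.one_closed by (metis card_1_singletonE singletonD)
  then obtain q where q: "prime q" "q dvd card A"
    using prime_factor_nat by blast
  define a where "a = multiplicity q (card A)"
  have "card A \<noteq> 0" using finA A.one_closed card_0_eq by blast
  then obtain m where m: "card A = q ^ a * m" "\<not> q dvd m"
    using multiplicity_decompose'[of "card A" q] q unfolding a_def by (metis not_prime_unit)
  have "a \<noteq> 0" using m q by (metis power_0 mult_1)
  obtain P where P: "subgroup P ?A" "card P = q ^ a"
    using sylow_thm[OF q(1) CA.group_axioms, of a m] m(1) finA by (auto simp: order_def)
  have PG: "subgroup P G"
    using P(1) A(1) incl_subgroup by blast
  have Peq: "P = {x \<in> A. x [^] (q ^ a) = \<one>}"
    using CA.sylow_eq_torsion[of q a m P] finA q(1) m P by (simp add: order_def flip: nat_pow_consistent)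
  show ?thesis
  proof (rule that[OF q(1) P(2) PG])
    show "P \<subseteq> H" using Peq A(2) by blast
    show "P \<noteq> {\<one>}"
    proof
      assume "P = {\<one>}"
      then have "q ^ a = 1" using P(2) by simp
      then show False using q(1) \<open>a \<noteq> 0\<close> by (simp add: prime_nat_iff)
    qed
    show "\<forall>h\<in>H. \<forall>x\<in>P. h \<otimes> x \<otimes> inv h \<in> P"
    proof (intro ballI)
      fix h x assume hx: "h \<in> H" "x \<in> P"
      then have c: "h \<in> carrier G" "x \<in> carrier G"
        using H(1) PG by (auto dest: subgroup.mem_carrier)
      have pow: "(h \<otimes> x \<otimes> inv h) [^] (n::nat) = h \<otimes> x [^] n \<otimes> inv h" for n
        using c by (induction n) (simp_all add: m_assoc)
      show "h \<otimes> x \<otimes> inv h \<in> P"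
        using hx nor pow c Peq by simp
    qed
  qed
qed

text \<open>A complement \<open>N\<close> is a transversal: \<open>N \<inter> M = {\<one>}\<close>
  separates the cosets \<open>n <# M\<close>, and \<open>NM = G\<close> reaches all of them.\<close>

lemma card_lcosets_complement:
  assumes M: "subgroup M G" and N: "subgroup N G" and NM: "N <#> M = carrier G" "N \<inter> M = {\<one>}"
  shows "card (lcosets M) = card N"
proof -
  interpret M: subgroup M G by fact
  interpret N: subgroup N G by fact
  have "inj_on (\<lambda>n. n <# M) N"
  proof
    fix x y assume xy: "x \<in> N" "y \<in> N" "x <# M = y <# M"
    then have "y \<in> x <# M" using lcos_self[OF _ M(1)] by auto
    then have "inv x \<otimes> y \<in> M"
      by (rule M.lcos_module_imp[OF is_group N.mem_carrier[OF xy(1)]])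
    moreover have "inv x \<otimes> y \<in> N" using xy by simp
    ultimately have "inv x \<otimes> y = \<one>" using NM(2) by blast
    then show "x = y" using xy by (metis N.mem_carrier inv_equality inv_inv N.m_inv_closed)
  qed
  moreover have "(\<lambda>n. n <# M) ` N = lcosets M"
  proof (intro equalityI subsetI)
    fix C assume "C \<in> lcosets M"
    then obtain g where g: "g \<in> carrier G" "C = g <# M" by (auto simp: LCOSETS_def)
    then obtain n m where nm: "n \<in> N" "m \<in> M" "g = n \<otimes> m" using NM(1) set_mult_iff by metis
    then have "g \<in> n <# M" by (auto simp: l_coset_def)
    then have "n <# M = g <# M" by (rule l_repr_independence[OF _ N.mem_carrier[OF nm(1)] M(1)])
    then show "C \<in> (\<lambda>n. n <# M) ` N" using g nm by blast
  qed (auto simp: LCOSETS_def)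
  ultimately show ?thesis by (metis card_image)
qed

text \<open>Let \<open>N\<close> be an abelian normal subgroup of \<open>G\<close> and \<open>P\<close> a normal \<open>q\<close>-subgroup of \<open>K\<close>. Both \<open>K\<close> and
  \<open>M\<close> are complements of \<open>N\<close>. Conjugation by \<open>P\<close> fixes only \<open>1\<close> in \<open>N\<close>, so \<open>|N| \<equiv> 1\<close> modulo \<open>q\<close>. As
  \<open>|G/M| = |N|\<close>, \<open>P\<close> fixes a coset \<open>gM\<close>, i.e. \<open>P \<subseteq> gMg\<inverse>\<close>. Now \<open>K\<close> and \<open>gMg\<inverse>\<close> both normalise
  \<open>P\<close>, so they coincide.\<close>

lemma core_free_maximal_conj:
  assumes fin: "finite (carrier G)" and solv: "solvable G"
    and K: "maximal_subgroup K G" "core_free G K" and M: "maximal_subgroup M G" "core_free G M"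
  shows "\<exists>g\<in>carrier G. K = conj_set G g M"
\<comment> \<open>A trivial \<open>K\<close> has no subgroup \<open>P\<close> to work with, but then
  \<open>K \<subseteq> M\<close> and maximality of \<open>K\<close> gives
  \<open>M = K\<close>.\<close>
proof (cases "K = {\<one>}")
  case True
  have "subgroup M G" "M \<noteq> carrier G" using M by (auto simp: maximal_subgroup_def)
  then have "M = K"
    using True K(1) subgroup.one_closed[of M G] by (auto simp: maximal_subgroup_def)
  then show ?thesis
    using conj_set_one subgroup.subset[OF \<open>subgroup M G\<close>] by (metis one_closed)
next
  case False
  have subK: "subgroup K G" and subM: "subgroup M G" using K M by (auto simp: maximal_subgroup_def)
  interpret K: subgroup K G by fact
  interpret M: subgroup M G by fact
  have nontriv: "carrier G \<noteq> {\<one>}"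
    using False K.subset K.one_closed by blast
  obtain N where N: "subgroup N G" "N \<subseteq> carrier G" "N \<noteq> {\<one>}"
    "\<forall>x\<in>N. \<forall>y\<in>N. x \<otimes> y = y \<otimes> x" "\<forall>h\<in>carrier G. \<forall>x\<in>N. h \<otimes> x \<otimes> inv h \<in> N"
    by (rule solvable_abelian_normal[OF subgroup_self solv[unfolded solvable_def] nontriv])
  then have Nc: "\<And>x y. x \<in> N \<Longrightarrow> y \<in> N \<Longrightarrow> x \<otimes> y = y \<otimes> x" by blast
  have Nn: "N \<lhd> G" using N by (simp add: normal_inv_iff)
  interpret N: normal N G by fact
  note NK = core_free_complement[OF K Nn N(3) Nc]
  note NM = core_free_complement[OF M Nn N(3) Nc]
  obtain P q a where q: "prime (q :: nat)" "card P = q ^ a" and P: "subgroup P G" "P \<subseteq> K" "P \<noteq> {\<one>}"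
    and KP': "\<forall>h\<in>K. \<forall>x\<in>P. h \<otimes> x \<otimes> inv h \<in> P"
    by (rule solvable_primary_normal[OF subK solvable_subgroup[OF subK solv] False fin])
  from KP' have KP: "\<And>h x. h \<in> K \<Longrightarrow> x \<in> P \<Longrightarrow> h \<otimes> x \<otimes> inv h \<in> P" by blast
  interpret P: subgroup P G by fact
  have finN: "finite N" using N.subset fin finite_subset by blast

  define C where "C = {x \<in> N. \<forall>p\<in>P. p \<otimes> x \<otimes> inv p = x}"
  have C_cong: "[card C = card N] (mod q)"
    unfolding C_def
  proof (rule subgroup_action_fixed_points_cong[OF P(1) q(2,1) finN])
    fix p x assume "p \<in> P" "x \<in> N"
    then show "p \<otimes> x \<otimes> inv p \<in> N" by (intro N.inv_op_closed2) auto
  next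
    fix p r x assume "p \<in> P" "r \<in> P" "x \<in> N"
    then show "p \<otimes> r \<otimes> x \<otimes> inv (p \<otimes> r) = p \<otimes> (r \<otimes> x \<otimes> inv r) \<otimes> inv p"
      by (simp add: group_word)
  qed simp
  have fixes_iff: "k \<otimes> x \<otimes> inv k = x \<longleftrightarrow> k \<otimes> x = x \<otimes> k" if "k \<in> carrier G" "x \<in> carrier G" for k x
    using that by (metis inv_solve_right m_closed)
  \<comment> \<open>\<open>C\<close> is the centraliser of \<open>P\<close> in \<open>N\<close>. In
    \<open>g = nk\<close>, the factor \<open>n\<close> commutes with all of \<open>N\<close>, while
    \<open>k\<close> normalises \<open>P\<close> and hence preserves \<open>C\<close>. So
    \<open>C\<close> is normal in \<open>G\<close>, and minimality of \<open>N\<close> leaves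
    \<open>C = {\<one>}\<close> or \<open>C = N\<close>.\<close>
  have C_closed: "g \<otimes> x \<otimes> inv g \<in> C" if g: "g \<in> carrier G" and x: "x \<in> C" for g x
  proof -
    obtain n k where nk: "n \<in> N" "k \<in> K" "g = n \<otimes> k"
      using g NK(1) set_mult_iff by metis
    have xN: "x \<in> N" and xP: "\<And>p. p \<in> P \<Longrightarrow> p \<otimes> x = x \<otimes> p"
      using x fixes_iff by (auto simp: C_def)
    define y where "y = k \<otimes> x \<otimes> inv k"
    have y: "y \<in> N" using nk xN by (auto simp: y_def intro: N.inv_op_closed2)
    have "g \<otimes> x \<otimes> inv g = n \<otimes> y \<otimes> inv n"
      using nk xN by (simp add: y_def group_word)
    also have "\<dots> = y"
      using nk y by (intro fixes_iff[THEN iffD2] Nc) auto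
    finally have gx: "g \<otimes> x \<otimes> inv g = y" .
    have "p \<otimes> y = y \<otimes> p" if p: "p \<in> P" for p
    proof -
      define r where "r = inv k \<otimes> p \<otimes> k"
      have r: "r \<in> P" using KP[of "inv k" p] nk p by (simp add: r_def)
      have "p = k \<otimes> r \<otimes> inv k" using nk p by (simp add: r_def group_word)
      then have "p \<otimes> y = k \<otimes> (r \<otimes> x) \<otimes> inv k" "y \<otimes> p = k \<otimes> (x \<otimes> r) \<otimes> inv k"
        using nk r xN by (simp_all add: y_def group_word)
      then show ?thesis using xP[OF r] by simp
    qed
    then have "p \<otimes> y \<otimes> inv p = y" if "p \<in> P" for p
      using that y by (intro fixes_iff[THEN iffD2]) auto
    then show ?thesis using gx y by (simp add: C_def)
  qed
  have "C \<lhd> G"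
    unfolding normal_inv_iff
  proof (intro conjI ballI C_closed)
    show "subgroup C G"
    proof (rule subgroupI)
      show "C \<subseteq> carrier G" "C \<noteq> {}"
        by (auto simp: C_def intro!: exI[of _ \<one>])
    next
      fix x assume x: "x \<in> C"
      then have xc: "x \<in> N" "\<And>p. p \<in> P \<Longrightarrow> p \<otimes> x \<otimes> inv p = x" by (auto simp: C_def)
      have "p \<otimes> inv x \<otimes> inv p = inv x" if "p \<in> P" for p
      proof -
        have "p \<otimes> inv x \<otimes> inv p = inv (p \<otimes> x \<otimes> inv p)"
          using xc(1) that by (simp add: group_word)
        then show ?thesis using xc(2)[OF that] by simp
      qed
      then show "inv x \<in> C" using xc(1) by (simp add: C_def)
    next
      fix x y assume "x \<in> C" "y \<in> C"
      then have xc: "x \<in> N" "\<And>p. p \<in> P \<Longrightarrow> p \<otimes> x \<otimes> inv p = x"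
        "y \<in> N" "\<And>p. p \<in> P \<Longrightarrow> p \<otimes> y \<otimes> inv p = y" by (auto simp: C_def)
      have "p \<otimes> (x \<otimes> y) \<otimes> inv p = x \<otimes> y" if "p \<in> P" for p
      proof -
        have "p \<otimes> (x \<otimes> y) \<otimes> inv p = (p \<otimes> x \<otimes> inv p) \<otimes> (p \<otimes> y \<otimes> inv p)"
          using xc(1,3) that by (simp add: group_word)
        then show ?thesis using xc(2,4) that by simp
      qed
      then show "x \<otimes> y \<in> C" using xc(1,3) by (simp add: C_def)
    qed
  qed
  \<comment> \<open>Otherwise \<open>N\<close> would centralise \<open>P\<close> and
    \<open>K\<close> normalises it, so \<open>P\<close> would be normal in \<open>NK = G\<close>,
    although it is nontrivial and lies in the core-free \<open>K\<close>.\<close>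
  have "C \<noteq> N"
  proof
    assume "C = N"
    then have cent: "p \<otimes> x = x \<otimes> p" if "p \<in> P" "x \<in> N" for p x
    proof -
      have "x \<in> C" using that \<open>C = N\<close> by simp
      then have "p \<otimes> x \<otimes> inv p = x" using that(1) by (simp add: C_def)
      then show ?thesis using that by (intro fixes_iff[THEN iffD1]) auto
    qed
    have "P \<lhd> G"
      unfolding normal_inv_iff
    proof (intro conjI ballI P(1))
      fix g p assume g: "g \<in> carrier G" and p: "p \<in> P"
      obtain n k where nk: "n \<in> N" "k \<in> K" "g = n \<otimes> k"
        using g NK(1) set_mult_iff by metis
      define r where "r = k \<otimes> p \<otimes> inv k"
      have r: "r \<in> P" using KP nk p by (simp add: r_def)
      have "g \<otimes> p \<otimes> inv g = n \<otimes> r \<otimes> inv n"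
        using nk p by (simp add: r_def group_word)
      also have "\<dots> = r" using cent[OF r nk(1)] r nk by (intro fixes_iff[THEN iffD2]) auto
      finally show "g \<otimes> p \<otimes> inv g \<in> P" using r by simp
    qed
    then show False using K(2) P by (auto simp: core_free_def)
  qed
  then have "C = {\<one>}"
    using core_free_minimal[OF K Nn N(3) Nc \<open>C \<lhd> G\<close>] by (auto simp: C_def)
  then have card_N: "[card N = 1] (mod q)"
    using C_cong by (simp add: cong_sym)

  define F where "F = {X \<in> lcosets M. \<forall>p\<in>P. p <# X = X}"
  have finL: "finite (lcosets M)"
    using fin lcosets_subset_PowG[OF subM] by (metis finite_Pow_iff finite_subset)
  have lc: "X \<subseteq> carrier G" if "X \<in> lcosets M" for X
    using M.lcosets_carrier[OF is_group that] .
  have "[card F = card (lcosets M)] (mod q)"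
    unfolding F_def
  proof (rule subgroup_action_fixed_points_cong[OF P(1) q(2,1) finL])
    fix p X assume p: "p \<in> P" and X: "X \<in> lcosets M"
    then obtain x where "x \<in> carrier G" "X = x <# M" by (auto simp: LCOSETS_def)
    then have "p <# X = (p \<otimes> x) <# M" "p \<otimes> x \<in> carrier G" using p by (simp_all add: lcos_m_assoc M.subset)
    then show "p <# X \<in> lcosets M" by (auto simp: LCOSETS_def)
  next
    fix X assume "X \<in> lcosets M" then show "\<one> <# X = X" using lc lcos_mult_one by blast
  next
    fix p r X assume "p \<in> P" "r \<in> P" "X \<in> lcosets M"
    then show "(p \<otimes> r) <# X = p <# (r <# X)" using lc by (simp add: lcos_m_assoc)
  qed
  then have "[card F = 1] (mod q)"
    using card_lcosets_complement[OF subM N(1) NM] card_N by (simp add: cong_def)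
  then have "card F \<noteq> 0"
    using q(1) by (metis cong_0_iff cong_sym not_prime_unit)
  then obtain X where X: "X \<in> F"
    by (metis card.empty equals0I)
  then obtain g where g: "g \<in> carrier G" "X = g <# M"
    by (auto simp: F_def LCOSETS_def)
  then have gP: "p <# (g <# M) = g <# M" if "p \<in> P" for p
    using X that by (simp add: F_def)
  note g = g(1)

  define L where "L = conj_set G g M"
  have L: "maximal_subgroup L G" "core_free G L"
    using maximal_subgroup_conj_set core_free_conj_set M g M.subset by (simp_all add: L_def)
  interpret L: subgroup L G using L(1) by (simp add: maximal_subgroup_def)
  note NL = core_free_complement[OF L Nn N(3) Nc]
  have PL: "P \<subseteq> L"
  proof
    fix p assume p: "p \<in> P"
    have "p \<otimes> g \<in> p <# (g <# M)"
      using lcos_self[OF g subM] unfolding l_coset_def[of G p] by blast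
    then have "p \<otimes> g \<in> g <# M" using gP[OF p] by simp
    then have "inv g \<otimes> (p \<otimes> g) \<in> M" by (rule M.lcos_module_imp[OF is_group g])
    also have "inv g \<otimes> (p \<otimes> g) = inv g \<otimes> p \<otimes> g"
      using p g by (intro m_assoc[symmetric]) auto
    finally show "p \<in> L"
      using P.mem_carrier[OF p] unfolding L_def conj_set_def by blast
  qed
  \<comment> \<open>With \<open>l = nk\<close> and \<open>r = k p k\<inverse>\<close>, the
    commutator of \<open>n\<close> and \<open>r\<close> lies in \<open>N\<close> by normality, and
    in \<open>L\<close> because it is the quotient of \<open>l p l\<inverse>\<close> and
    \<open>r\<close>, both in \<open>L\<close>. Since \<open>N \<inter> L\<close> is trivial,
    \<open>l p l\<inverse> = r\<close>.\<close>
  have LP: "l \<otimes> p \<otimes> inv l \<in> P" if l: "l \<in> L" and p: "p \<in> P" for l p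
  proof -
    obtain n k where nk: "n \<in> N" "k \<in> K" "l = n \<otimes> k"
      using l NK(1) set_mult_iff L.mem_carrier by metis
    define r where "r = k \<otimes> p \<otimes> inv k"
    have r: "r \<in> P" using KP nk p by (simp add: r_def)
    have lp: "l \<otimes> p \<otimes> inv l = n \<otimes> r \<otimes> inv n"
      using nk p by (simp add: r_def group_word)
    have "n \<otimes> r \<otimes> inv n \<otimes> inv r = n \<otimes> (r \<otimes> inv n \<otimes> inv r)"
      using nk r by (simp add: group_word)
    moreover have "r \<otimes> inv n \<otimes> inv r \<in> N" using nk r by (intro N.inv_op_closed2) auto
    ultimately have "n \<otimes> r \<otimes> inv n \<otimes> inv r \<in> N" using nk by simp
    moreover have "n \<otimes> r \<otimes> inv n \<otimes> inv r \<in> L"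
      using lp l p r PL by (metis L.m_closed L.m_inv_closed subsetD)
    ultimately have "n \<otimes> r \<otimes> inv n \<otimes> inv r = \<one>" using NL(2) by blast
    then have "n \<otimes> r \<otimes> inv n = r"
      using nk r by (metis N.mem_carrier P.mem_carrier inv_closed inv_equality inv_inv m_closed)
    then show ?thesis using lp r by simp
  qed
  have "K = L"
    by (rule maximal_eq_if_normalise[OF K L(1) P(1,3,2) KP LP])
  then show ?thesis using g L_def by blast
qed

end

subsection \<open>Ore's theorem on maximal subgroups\<close>

context group_hom
begin

text \<open>A subgroup containing the kernel is the full preimage of its image. This carries
  maximality, core-freeness and conjugacy between \<open>G\<close> and its quotient.\<close>

lemma mem_img_iff:
  assumes "subgroup K G" "kernel G H h \<subseteq> K" "x \<in> carrier G"
  shows "h x \<in> h ` K \<longleftrightarrow> x \<in> K"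
proof
  interpret K: subgroup K G by fact
  assume "h x \<in> h ` K"
  then obtain k where k: "k \<in> K" "h x = h k" by blast
  then have "h (x \<otimes> inv k) = \<one>\<^bsub>H\<^esub>" using assms(3) by simp
  then have "x \<otimes> inv k \<in> K" using assms(2,3) k(1) by (auto simp: kernel_def)
  then have "x \<otimes> inv k \<otimes> k \<in> K" using k(1) by blast
  then show "x \<in> K" using assms(3) k(1) by (simp add: G.m_assoc)
qed blast

lemma subgroup_vimage:
  assumes "subgroup L H"
  shows "subgroup {x \<in> carrier G. h x \<in> L} G"
proof -
  interpret L: subgroup L H by fact
  show ?thesis by (rule G.subgroupI) (auto intro!: exI[of _ \<one>])
qed

lemma maximal_subgroup_img:
  assumes surj: "h ` carrier G = carrier H" and K: "maximal_subgroup K G" "kernel G H h \<subseteq> K"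
  shows "maximal_subgroup (h ` K) H"
  unfolding maximal_subgroup_def
proof (intro conjI allI impI)
  have sub: "subgroup K G" "K \<noteq> carrier G" using K(1) by (auto simp: maximal_subgroup_def)
  show "subgroup (h ` K) H" by (rule subgroup_img_is_subgroup[OF sub(1)])
  show "h ` K \<noteq> carrier H"
  proof
    assume "h ` K = carrier H"
    then have "carrier G \<subseteq> K" using mem_img_iff[OF sub(1) K(2)] by auto
    then show False using sub subgroup.subset by blast
  qed
  fix L assume L: "subgroup L H" "h ` K \<subseteq> L"
  let ?L = "{x \<in> carrier G. h x \<in> L}"
  have "L = h ` ?L"
  proof (intro equalityI subsetI)
    fix y assume y: "y \<in> L"
    then have "y \<in> h ` carrier G" using surj subgroup.mem_carrier[OF L(1)] by simp
    then show "y \<in> h ` ?L" using y by auto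
  qed auto
  moreover have "K \<subseteq> ?L"
  proof
    fix x assume "x \<in> K"
    then show "x \<in> ?L" using L(2) subgroup.mem_carrier[OF sub(1)] by auto
  qed
  then have "?L = K \<or> ?L = carrier G"
    using K(1) subgroup_vimage[OF L(1)] unfolding maximal_subgroup_def by blast
  ultimately show "L = h ` K \<or> L = carrier H" using surj by metis
qed

lemma conj_set_img_imp:
  assumes K: "subgroup K G" "kernel G H h \<subseteq> K" and M: "subgroup M G" "kernel G H h \<subseteq> M"
    and g: "g \<in> carrier G" and eq: "h ` K = conj_set H (h g) (h ` M)"
  shows "K = conj_set G g M"
proof -
  have "x \<in> K \<longleftrightarrow> inv g \<otimes> x \<otimes> g \<in> M" if x: "x \<in> carrier G" for x
  proof -
    have "x \<in> K \<longleftrightarrow> h x \<in> h ` K" using mem_img_iff[OF K x] by simp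
    also have "\<dots> \<longleftrightarrow> h (inv g \<otimes> x \<otimes> g) \<in> h ` M"
      using g x by (simp add: eq conj_set_def)
    also have "\<dots> \<longleftrightarrow> inv g \<otimes> x \<otimes> g \<in> M"
      using g x by (intro mem_img_iff[OF M]) simp
    finally show ?thesis .
  qed
  then show ?thesis
    using subgroup.subset[OF K(1)] by (auto simp: conj_set_def)
qed

end

text \<open>For a subgroup \<open>K\<close>, the intersection of its conjugates, i.e. the largest
  normal subgroup of \<open>G\<close> inside \<open>K\<close>.\<close>

definition core :: "('a, 'c) monoid_scheme \<Rightarrow> 'a set \<Rightarrow> 'a set"
  where "core G K = {x \<in> carrier G. \<forall>g\<in>carrier G. g \<otimes>\<^bsub>G\<^esub> x \<otimes>\<^bsub>G\<^esub> inv\<^bsub>G\<^esub> g \<in> K}"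

lemma (in group) core_subset: "core G K \<subseteq> K"
proof
  fix x assume "x \<in> core G K"
  then have "x \<in> carrier G" "\<one> \<otimes> x \<otimes> inv \<one> \<in> K" unfolding core_def by blast+
  then show "x \<in> K" by simp
qed

lemma (in group) normal_core:
  assumes "subgroup K G"
  shows "core G K \<lhd> G"
  unfolding normal_inv_iff
proof (intro conjI ballI)
  interpret K: subgroup K G by fact
  show "subgroup (core G K) G"
  proof (rule subgroupI)
    show "core G K \<subseteq> carrier G" "core G K \<noteq> {}"
      by (auto simp: core_def intro!: exI[of _ \<one>])
  next
    fix x assume x: "x \<in> core G K"
    have "g \<otimes> inv x \<otimes> inv g \<in> K" if g: "g \<in> carrier G" for g
    proof -
      have "g \<otimes> inv x \<otimes> inv g = inv (g \<otimes> x \<otimes> inv g)"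
        using x g by (simp add: core_def group_word)
      then show ?thesis using x g by (simp add: core_def)
    qed
    then show "inv x \<in> core G K" using x by (simp add: core_def)
  next
    fix x y assume xy: "x \<in> core G K" "y \<in> core G K"
    have "g \<otimes> (x \<otimes> y) \<otimes> inv g \<in> K" if g: "g \<in> carrier G" for g
    proof -
      have "g \<otimes> (x \<otimes> y) \<otimes> inv g = (g \<otimes> x \<otimes> inv g) \<otimes> (g \<otimes> y \<otimes> inv g)"
        using xy g by (simp add: core_def group_word)
      then show ?thesis using xy g by (simp add: core_def)
    qed
    then show "x \<otimes> y \<in> core G K" using xy by (simp add: core_def)
  qed
next
  fix g x assume gx: "g \<in> carrier G" "x \<in> core G K"
  have "f \<otimes> (g \<otimes> x \<otimes> inv g) \<otimes> inv f \<in> K" if f: "f \<in> carrier G" for f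
  proof -
    have "f \<otimes> (g \<otimes> x \<otimes> inv g) \<otimes> inv f = (f \<otimes> g) \<otimes> x \<otimes> inv (f \<otimes> g)"
      using gx f by (simp add: core_def group_word)
    then show ?thesis using gx f by (simp add: core_def)
  qed
  then show "g \<otimes> x \<otimes> inv g \<in> core G K" using gx by (simp add: core_def)
qed

lemma (in group) normal_subset_core:
  assumes "N \<lhd> G" "N \<subseteq> K"
  shows "N \<subseteq> core G K"
proof
  interpret N: normal N G by fact
  fix x assume "x \<in> N"
  then show "x \<in> core G K"
    using N.inv_op_closed2 assms(2) by (simp add: core_def subset_iff)
qed

text \<open>A normal subgroup inside the image pulls back to a normal subgroup inside
  \<open>K\<close>, hence into the core, which is the kernel.\<close>

lemma (in group_hom) core_free_img:
  assumes surj: "h ` carrier G = carrier H" and K: "subgroup K G" "kernel G H h = core G K"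
  shows "core_free H (h ` K)"
  unfolding core_free_def
proof (intro allI impI)
  fix R assume R: "R \<lhd> H" "R \<subseteq> h ` K"
  interpret R: normal R H by fact
  let ?R = "{x \<in> carrier G. h x \<in> R}"
  have "?R \<lhd> G"
    unfolding G.normal_inv_iff
  proof (intro conjI ballI)
    show "subgroup ?R G" by (rule subgroup_vimage[OF R.subgroup_axioms])
    fix g x assume gx: "g \<in> carrier G" "x \<in> ?R"
    then have "h g \<otimes>\<^bsub>H\<^esub> h x \<otimes>\<^bsub>H\<^esub> inv\<^bsub>H\<^esub> h g \<in> R"
      by (intro R.inv_op_closed2) auto
    then show "g \<otimes> x \<otimes> inv g \<in> ?R" using gx by simp
  qed
  moreover have "?R \<subseteq> K"
  proof
    fix x assume "x \<in> ?R"
    then have "x \<in> carrier G" "h x \<in> h ` K" using R(2) by auto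
    then show "x \<in> K" using mem_img_iff[OF K(1)] K(2) G.core_subset by simp
  qed
  ultimately have "?R \<subseteq> kernel G H h" unfolding K(2) by (rule G.normal_subset_core)
  then have *: "h x = \<one>\<^bsub>H\<^esub>" if "x \<in> carrier G" "h x \<in> R" for x
    using that by (auto simp: kernel_def)
  have "y = \<one>\<^bsub>H\<^esub>" if "y \<in> R" for y
  proof -
    have "y \<in> h ` carrier G" using surj R.mem_carrier[OF that] by simp
    then show ?thesis using * that by auto
  qed
  then show "R = {\<one>\<^bsub>H\<^esub>}" using R.one_closed by blast
qed

context group
begin

lemma set_mult_carrier_commute:
  assumes "subgroup K G" "subgroup M G" "M <#> K = carrier G"
  shows "K <#> M = carrier G"
proof -
  interpret K: subgroup K G by fact
  interpret M: subgroup M G by fact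
  have "x \<in> K <#> M" if x: "x \<in> carrier G" for x
  proof -
    obtain m k where mk: "m \<in> M" "k \<in> K" "inv x = m \<otimes> k"
      using assms(3) x set_mult_iff inv_closed by metis
    then have "x = inv (m \<otimes> k)" using x by (metis inv_inv)
    then have "x = inv k \<otimes> inv m" using mk by (simp add: inv_mult_group)
    then show ?thesis using mk set_mult_iff by blast
  qed
  then show ?thesis
    using setmult_subset_G[OF K.subset M.subset] by blast
qed

text \<open>If the core of \<open>K\<close> were not inside \<open>M\<close>, its product with
  \<open>M\<close> would be \<open>G\<close> and lie in \<open>KM\<close>. So each core lies in the
  other subgroup, and the two cores coincide. Modulo this common core both subgroups are core-free,
  hence conjugate, and the conjugacy lifts.\<close>

theorem maximal_conj_or_factorize:
  assumes fin: "finite (carrier G)" and solv: "solvable G"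
    and K: "maximal_subgroup K G" and M: "maximal_subgroup M G" and ne: "K <#> M \<noteq> carrier G"
  shows "\<exists>g\<in>carrier G. K = conj_set G g M"
proof -
  have sub: "subgroup K G" "subgroup M G" using K M by (auto simp: maximal_subgroup_def)
  have carr: "K \<subseteq> carrier G" "M \<subseteq> carrier G" using sub by (auto dest: subgroup.subset)
  define D where "D = core G K"
  have D: "D \<lhd> G" using normal_core sub by (simp add: D_def)
  interpret D: normal D G by fact
  have "D \<subseteq> M"
  proof (rule ccontr)
    assume "\<not> D \<subseteq> M"
    then have "carrier G \<subseteq> K <#> M"
      using set_mult_maximal[OF M D] mono_set_mult[of D K M M G] core_subset by (auto simp: D_def)
    then show False using ne setmult_subset_G[OF carr] by blast
  qed
  moreover have "core G M \<subseteq> K"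
  proof (rule ccontr)
    assume "\<not> core G M \<subseteq> K"
    then have "carrier G \<subseteq> M <#> K"
      using set_mult_maximal[OF K normal_core[OF sub(2)]] mono_set_mult[of "core G M" M K K G] core_subset by auto
    then have "M <#> K = carrier G" using setmult_subset_G[OF carr(2,1)] by blast
    then show False using ne set_mult_carrier_commute[OF sub] by blast
  qed
  ultimately have DM: "D = core G M"
    using normal_subset_core D normal_core sub by (metis D_def equalityI)
  interpret h: group_hom G "G Mod D" "\<lambda>x. D #> x"
    using D.r_coset_hom_Mod D.factorgroup_is_group by (auto simp: group_hom_def group_hom_axioms_def)
  have surj: "(\<lambda>x. D #> x) ` carrier G = carrier (G Mod D)"
    by (simp add: carrier_FactGroup)
  have ker: "kernel G (G Mod D) (\<lambda>x. D #> x) = D"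
  proof (intro equalityI subsetI)
    fix x assume "x \<in> kernel G (G Mod D) (\<lambda>x. D #> x)"
    then have "x \<in> carrier G" "D #> x = D" by (auto simp: kernel_def)
    then show "x \<in> D" using rcos_self[OF _ D.subgroup_axioms] by metis
  next
    fix x assume "x \<in> D"
    then show "x \<in> kernel G (G Mod D) (\<lambda>x. D #> x)"
      using coset_join2[OF _ D.subgroup_axioms] by (simp add: kernel_def)
  qed
  have kK: "kernel G (G Mod D) (\<lambda>x. D #> x) \<subseteq> K" and kM: "kernel G (G Mod D) (\<lambda>x. D #> x) \<subseteq> M"
    using ker D_def core_subset \<open>D \<subseteq> M\<close> by auto
  have "finite (carrier (G Mod D))" using fin surj by (metis finite_imageI)
  moreover have "solvable (G Mod D)" by (rule h.surj_hom_imp_solvable[OF surj solv])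
  ultimately obtain y where y: "y \<in> carrier (G Mod D)"
      "(\<lambda>x. D #> x) ` K = conj_set (G Mod D) y ((\<lambda>x. D #> x) ` M)"
    using h.H.core_free_maximal_conj h.maximal_subgroup_img[OF surj K kK]
      h.maximal_subgroup_img[OF surj M kM] h.core_free_img[OF surj sub(1)]
      h.core_free_img[OF surj sub(2)] ker D_def DM by metis
  then obtain g where g: "g \<in> carrier G" "y = D #> g" using surj by blast
  show ?thesis
    using h.conj_set_img_imp[OF sub(1) kK sub(2) kM g(1)] y(2) g by blast
qed

end

subsection \<open>Independence of coset functions\<close>

text \<open>The partial sum \<open>P\<close> over \<open>X\<close> and the remainder
  \<open>R\<close> satisfy \<open>P = - R\<close> and are orthogonal, so \<open>P\<close> has norm
  zero. Real \<open>f\<close> allows \<open>orth\<close> to be stated without complex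
  conjugation.\<close>

lemma orthogonal_blocks_vanish:
  fixes f :: "'i \<Rightarrow> 'x \<Rightarrow> real" and c :: "'i \<Rightarrow> complex"
  assumes fin: "finite I" and fS: "finite S" and X: "X \<subseteq> I"
    and zero: "\<And>x. x \<in> S \<Longrightarrow> (\<Sum>i\<in>I. c i * of_real (f i x)) = 0"
    and orth: "\<And>i j. i \<in> X \<Longrightarrow> j \<in> I - X \<Longrightarrow> (\<Sum>x\<in>S. f j x * f i x) = 0"
    and x: "x \<in> S"
  shows "(\<Sum>i\<in>X. c i * of_real (f i x)) = 0"
proof -
  define P where "P x = (\<Sum>i\<in>X. c i * of_real (f i x))" for x
  define R where "R x = (\<Sum>i\<in>I-X. c i * of_real (f i x))" for x
  have PR: "P x = - R x" if "x \<in> S" for x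
    using zero[OF that] sum.subset_diff[OF X fin, of "\<lambda>i. c i * of_real (f i x)"]
    by (simp add: P_def R_def eq_neg_iff_add_eq_0 add.commute)
  have "(\<Sum>x\<in>S. R x * cnj (P x)) = (\<Sum>x\<in>S. \<Sum>j\<in>I-X. \<Sum>i\<in>X. c j * cnj (c i) * of_real (f j x * f i x))"
    unfolding P_def R_def cnj_sum sum_product by (intro sum.cong refl) simp
  also have "\<dots> = (\<Sum>j\<in>I-X. \<Sum>x\<in>S. \<Sum>i\<in>X. c j * cnj (c i) * of_real (f j x * f i x))"
    by (rule sum.swap)
  also have "\<dots> = (\<Sum>j\<in>I-X. \<Sum>i\<in>X. \<Sum>x\<in>S. c j * cnj (c i) * of_real (f j x * f i x))"
    by (intro sum.cong refl sum.swap)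
  also have "\<dots> = (\<Sum>j\<in>I-X. \<Sum>i\<in>X. c j * cnj (c i) * of_real (\<Sum>x\<in>S. f j x * f i x))"
    by (simp only: sum_distrib_left of_real_sum)
  also have "\<dots> = 0"
    by (intro sum.neutral ballI) (simp only: orth of_real_0 mult_zero_right)
  finally have "(\<Sum>x\<in>S. R x * cnj (P x)) = 0" .
  moreover have "(\<Sum>x\<in>S. R x * cnj (P x)) = - of_real (\<Sum>x\<in>S. (cmod (P x))\<^sup>2)"
  proof -
    have "R x * cnj (P x) = - of_real ((cmod (P x))\<^sup>2)" if "x \<in> S" for x
      using PR[OF that] complex_norm_square[of "P x"] by simp
    then have "(\<Sum>x\<in>S. R x * cnj (P x)) = (\<Sum>x\<in>S. - of_real ((cmod (P x))\<^sup>2))"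
      by (rule sum.cong[OF refl])
    then show ?thesis by (simp add: sum_negf)
  qed
  ultimately have "(\<Sum>x\<in>S. (cmod (P x))\<^sup>2) = 0"
    by (metis neg_equal_0_iff_equal of_real_eq_0_iff)
  then have "(cmod (P x))\<^sup>2 = 0"
    using x fS by (simp add: sum_nonneg_eq_0_iff)
  then show ?thesis by (simp add: P_def)
qed

text \<open>The subtracted constant is the mean of the indicator over \<open>G\<close>.\<close>

definition coset_fun :: "('a, 'c) monoid_scheme \<Rightarrow> 'a set \<Rightarrow> 'a \<Rightarrow> 'a \<Rightarrow> real"
  where "coset_fun G K t x = (if x \<in> t <#\<^bsub>G\<^esub> K then 1 else 0) - real (card K) / real (order G)"

context group
begin

section \<open>Intersections of cosets and orthogonality of their centred indicators\<close>

lemma mem_lcoset_iff: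
  assumes "subgroup K G" "t \<in> carrier G"
  shows "x \<in> t <# K \<longleftrightarrow> x \<in> carrier G \<and> inv t \<otimes> x \<in> K"
proof
  interpret K: subgroup K G by fact
  assume x: "x \<in> t <# K"
  then obtain k where "k \<in> K" "x = t \<otimes> k" by (auto simp: l_coset_def)
  then show "x \<in> carrier G \<and> inv t \<otimes> x \<in> K" using assms(2) by simp
next
  assume x: "x \<in> carrier G \<and> inv t \<otimes> x \<in> K"
  then have "x = t \<otimes> (inv t \<otimes> x)" using assms(2) by simp
  then show "x \<in> t <# K" using x unfolding l_coset_def by blast
qed

lemma card_lcoset:
  assumes "subgroup K G" "t \<in> carrier G" "finite (carrier G)"
  shows "card (t <# K) = card K"
proof -
  have "t <# K \<in> lcosets K" using assms(2) unfolding LCOSETS_def by blast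
  then show ?thesis
    using l_card_cosets_equal[OF _ subgroup.subset[OF assms(1)] assms(3)] by simp
qed

text \<open>The factorization forces any two cosets to meet, and then they meet in a coset of
  \<open>K \<inter> M\<close>. Cutting \<open>K\<close> by all cosets of \<open>M\<close> gives
  \<open>|K| = |G:M| |K \<inter> M|\<close>.\<close>

lemma card_lcosets_Int:
  assumes fin: "finite (carrier G)" and K: "subgroup K G" and M: "subgroup M G"
    and KM: "K <#> M = carrier G" and ts: "t \<in> carrier G" "s \<in> carrier G"
  shows "card ((t <# K) \<inter> (s <# M)) * order G = card K * card M"
proof -
  interpret K: subgroup K G by fact
  interpret M: subgroup M G by fact
  have KMs: "subgroup (K \<inter> M) G" by (intro subgroups_Inter_pair K M)
  have Int: "card ((t <# K) \<inter> (s <# M)) = card (K \<inter> M)" if ts: "t \<in> carrier G" "s \<in> carrier G" for t s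
  proof -
    \<comment> \<open>Factoring \<open>inv t \<otimes> s\<close> produces a common point of the two
      cosets, \<open>y = t \<otimes> k = s \<otimes> inv m\<close>.\<close>
    obtain k m where km: "k \<in> K" "m \<in> M" "inv t \<otimes> s = k \<otimes> m"
      using KM ts set_mult_iff inv_closed m_closed by metis
    define y where "y = t \<otimes> k"
    have y: "y \<in> carrier G" using ts km by (simp add: y_def)
    have "s = t \<otimes> (inv t \<otimes> s)" using ts by simp
    also have "\<dots> = y \<otimes> m" unfolding km(3) using ts km by (simp add: y_def m_assoc)
    finally have "inv m = inv s \<otimes> y" using ts y km by (simp add: inv_mult_group m_assoc)
    then have "y \<in> s <# M" using y ts M.m_inv_closed[OF km(2)] by (simp add: mem_lcoset_iff[OF M])
    then have sM: "s <# M = y <# M" by (rule l_repr_independence[OF _ ts(2) M])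
    have "y \<in> t <# K" using km unfolding y_def l_coset_def by blast
    then have tK: "t <# K = y <# K" by (rule l_repr_independence[OF _ ts(1) K])
    have "(t <# K) \<inter> (s <# M) = y <# (K \<inter> M)"
      unfolding tK sM by (auto simp: mem_lcoset_iff[OF _ y] K M KMs)
    then show ?thesis using card_lcoset[OF KMs y fin] by simp
  qed
  have part: "K = (\<Union>X\<in>lcosets M. K \<inter> X)"
    using lcosets_part_G[OF M] K.subset by blast
  have "card K = (\<Sum>X\<in>lcosets M. card (K \<inter> X))"
  proof (subst part, rule card_UN_disjoint)
    show "finite (lcosets M)"
      using fin lcosets_subset_PowG[OF M] by (metis finite_Pow_iff finite_subset)
    show "\<forall>X\<in>lcosets M. finite (K \<inter> X)"
      using fin K.subset by (metis finite_Int finite_subset)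
    show "\<forall>X\<in>lcosets M. \<forall>Y\<in>lcosets M. X \<noteq> Y \<longrightarrow> K \<inter> X \<inter> (K \<inter> Y) = {}"
      using lcos_disjoint[OF M] by blast
  qed
  also have "\<dots> = (\<Sum>X\<in>lcosets M. card (K \<inter> M))"
  proof (rule sum.cong[OF refl])
    fix X assume "X \<in> lcosets M"
    then obtain x where "x \<in> carrier G" "X = x <# M" by (auto simp: LCOSETS_def)
    then show "card (K \<inter> X) = card (K \<inter> M)"
      using Int[OF one_closed, of x] lcos_mult_one[OF K.subset] by simp
  qed
  also have "\<dots> * card M = card (K \<inter> M) * order G"
    using l_lagrange[OF fin M] by (simp add: mult_ac)
  finally show ?thesis using Int[OF ts] by simp
qed

lemma order_pos: "finite (carrier G) \<Longrightarrow> order G > 0"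
  using order_gt_0_iff_finite by simp

lemma sum_coset_fun:
  assumes fin: "finite (carrier G)" and K: "subgroup K G" "t \<in> carrier G"
  shows "(\<Sum>x\<in>carrier G. coset_fun G K t x) = 0"
proof -
  have "t <# K \<subseteq> carrier G" using mem_lcoset_iff[OF K] by blast
  then have "(\<Sum>x\<in>carrier G. if x \<in> t <# K then 1 else 0) = real (card (t <# K))"
    using fin by (simp add: sum.If_cases Int_absorb1)
  then show ?thesis
    using card_lcoset[OF K fin] order_pos[OF fin]
    by (simp add: coset_fun_def sum_subtractf order_def[symmetric])
qed

text \<open>The intersection has exactly the size expected of independent events, so the covariance
  of the two indicators is zero.\<close>

lemma sum_coset_fun_mult:
  assumes fin: "finite (carrier G)" and K: "subgroup K G" and M: "subgroup M G"
    and KM: "K <#> M = carrier G" and ts: "t \<in> carrier G" "s \<in> carrier G"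
  shows "(\<Sum>x\<in>carrier G. coset_fun G K t x * coset_fun G M s x) = 0"
proof -
  let ?k = "real (card K) / real (order G)" and ?m = "real (card M) / real (order G)"
  let ?I = "\<lambda>A x. if x \<in> A then 1 else 0 :: real"
  \<comment> \<open>Only the second mean is split off with its factor intact, because that factor
    already sums to zero.\<close>
  have "(\<Sum>x\<in>carrier G. coset_fun G K t x * coset_fun G M s x)
      = (\<Sum>x\<in>carrier G. ?I ((t <# K) \<inter> (s <# M)) x - ?k * ?I (s <# M) x) - ?m * (\<Sum>x\<in>carrier G. coset_fun G K t x)"
    unfolding sum_distrib_left sum_subtractf[symmetric]
    by (rule sum.cong) (auto simp: coset_fun_def algebra_simps)
  also have "\<dots> = (\<Sum>x\<in>carrier G. ?I ((t <# K) \<inter> (s <# M)) x) - ?k * (\<Sum>x\<in>carrier G. ?I (s <# M) x)"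
    using sum_coset_fun[OF fin K ts(1)] by (simp add: sum_subtractf sum_distrib_left)
  also have "(\<Sum>x\<in>carrier G. ?I (s <# M) x) = real (card M)"
  proof -
    have "s <# M \<subseteq> carrier G" using mem_lcoset_iff[OF M ts(2)] by blast
    then show ?thesis
      using fin card_lcoset[OF M ts(2) fin] by (simp add: sum.If_cases Int_absorb1)
  qed
  also have "(\<Sum>x\<in>carrier G. ?I ((t <# K) \<inter> (s <# M)) x) = real (card ((t <# K) \<inter> (s <# M)))"
  proof -
    have "(t <# K) \<inter> (s <# M) \<subseteq> carrier G" using mem_lcoset_iff[OF M ts(2)] by blast
    then have "carrier G \<inter> {x. x \<in> (t <# K) \<inter> (s <# M)} = (t <# K) \<inter> (s <# M)" by blast
    then show ?thesis
      using fin by (simp only: sum.If_cases) simp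
  qed
  also have "real (card ((t <# K) \<inter> (s <# M))) = ?k * real (card M)"
    using card_lcosets_Int[OF fin K M KM ts] order_pos[OF fin]
    by (simp add: field_simps flip: of_nat_mult)
  finally show ?thesis by simp
qed

section \<open>Conjugacy classes and the independence argument\<close>

lemma conj_set_self:
  assumes K: "subgroup K G" "k \<in> K"
  shows "conj_set G k K = K"
proof -
  interpret K: subgroup K G by fact
  have "x \<in> K" if "x \<in> carrier G" "inv k \<otimes> x \<otimes> k \<in> K" for x
  proof -
    have "k \<otimes> (inv k \<otimes> x \<otimes> k) \<otimes> inv k \<in> K"
      by (intro K.m_closed that K K.m_inv_closed)
    also have "k \<otimes> (inv k \<otimes> x \<otimes> k) \<otimes> inv k = x"
      using that(1) K(2) by (simp add: group_word)
    finally show ?thesis .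
  qed
  moreover have "inv k \<otimes> x \<otimes> k \<in> K" if "x \<in> K" for x
    by (intro K.m_closed that K K.m_inv_closed)
  ultimately show ?thesis
    unfolding conj_set_def using K.mem_carrier by blast
qed

text \<open>A coset determines its conjugate, as \<open>K\<close> normalises itself. Distinct
  conjugates of one base therefore get disjoint cosets.\<close>

lemma conj_set_eq_if_lcoset:
  assumes K: "subgroup K G" and g: "g \<in> carrier G" and h: "h \<in> g <# K"
  shows "conj_set G h K = conj_set G g K"
proof -
  obtain k where k: "k \<in> K" "h = g \<otimes> k" using h by (auto simp: l_coset_def)
  then have "conj_set G h K = conj_set G g (conj_set G k K)"
    using g subgroup.mem_carrier[OF K] by (simp add: conj_set_mult)
  then show ?thesis using conj_set_self[OF K k(1)] by simp
qed

definition conjugate_sets :: "'a set \<Rightarrow> 'a set \<Rightarrow> bool"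
  where "conjugate_sets K M \<longleftrightarrow> (\<exists>g\<in>carrier G. K = conj_set G g M)"

lemma conjugate_sets_refl: "K \<subseteq> carrier G \<Longrightarrow> conjugate_sets K K"
  unfolding conjugate_sets_def using conj_set_one by (metis one_closed)

lemma conjugate_sets_sym:
  assumes "M \<subseteq> carrier G" "conjugate_sets K M"
  shows "conjugate_sets M K"
  using assms conj_set_inv[OF assms(1)] unfolding conjugate_sets_def by (metis inv_closed)

lemma conjugate_sets_trans: "conjugate_sets K L \<Longrightarrow> conjugate_sets L M \<Longrightarrow> conjugate_sets K M"
  unfolding conjugate_sets_def by (metis conj_set_mult m_closed)

text \<open>Here \<open>b i\<close> is the base of the conjugacy class of \<open>K i\<close>, and the coset attached to \<open>i\<close> is \<open>t i\<close> times \<open>K (d i)\<close>.\<close>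

lemma coset_fun_independent:
  fixes c :: "'i \<Rightarrow> complex"
  assumes fin: "finite (carrier G)" "finite I"
    and max: "\<And>i. i \<in> I \<Longrightarrow> maximal_subgroup (K i) G" and inj: "inj_on K I"
    and b: "\<And>i. i \<in> I \<Longrightarrow> b i \<in> I \<and> b (b i) = b i"
    and d: "\<And>i. i \<in> I \<Longrightarrow> d i \<in> I \<and> t i \<in> carrier G \<and> K i = conj_set G (t i) (K (d i))"
    and d_b: "\<And>i. i \<in> I \<Longrightarrow> b i \<noteq> i \<Longrightarrow> d i = b i"
    and d_base: "\<And>i. i \<in> I \<Longrightarrow> b i = i \<Longrightarrow> d i = i \<Longrightarrow> (\<forall>j\<in>I. b j = i \<longrightarrow> j = i)"
    and KK: "\<And>i j. i \<in> I \<Longrightarrow> j \<in> I \<Longrightarrow> b i \<noteq> b j \<Longrightarrow> K (d i) <#> K (d j) = carrier G"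
    and zero: "\<And>x. x \<in> carrier G \<Longrightarrow> (\<Sum>i\<in>I. c i * of_real (coset_fun G (K (d i)) (t i) x)) = 0"
    and i: "i \<in> I"
  shows "c i = 0"
proof -
  define \<beta> where "\<beta> = b i"
  define X where "X = {j \<in> I. b j = \<beta>}"
  define B where "B = K \<beta>"
  have \<beta>: "\<beta> \<in> I" "b \<beta> = \<beta>" "\<beta> \<in> X" "i \<in> X" using b[OF i] i by (auto simp: \<beta>_def X_def)
  have finX: "finite X" using fin(2) by (simp add: X_def)
  have sub: "subgroup (K j) G" if "j \<in> I" for j using max[OF that] by (simp add: maximal_subgroup_def)
  have B: "subgroup B G" "B \<noteq> carrier G"
    using max[OF \<beta>(1)] by (auto simp: B_def maximal_subgroup_def)
  interpret B: subgroup B G by (rule B(1))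
  have dI: "d j \<in> I" and tG: "t j \<in> carrier G" and Kd: "K j = conj_set G (t j) (K (d j))" if "j \<in> I" for j
    using d[OF that] by blast+
  \<comment> \<open>Coset functions from different classes are orthogonal, so the relation splits
    into one relation for each class.\<close>
  have block: "(\<Sum>j\<in>X. c j * of_real (coset_fun G (K (d j)) (t j) x)) = 0" if x: "x \<in> carrier G" for x
  proof (rule orthogonal_blocks_vanish[OF fin(2,1) _ zero _ x])
    show "X \<subseteq> I" by (auto simp: X_def)
    fix j k assume "j \<in> X" "k \<in> I - X"
    then have "j \<in> I" "k \<in> I" "b k \<noteq> b j" by (auto simp: X_def)
    then show "(\<Sum>x\<in>carrier G. coset_fun G (K (d k)) (t k) x * coset_fun G (K (d j)) (t j) x) = 0"
      by (intro sum_coset_fun_mult[OF fin(1)] sub dI tG KK)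
  qed
  have \<kappa>: "0 < card B" "card B < order G"
  proof -
    have "finite B" using B.subset fin(1) finite_subset by blast
    then show "0 < card B" using B.one_closed card_gt_0_iff by blast
    show "card B < order G"
      unfolding order_def using B(2) B.subset fin(1) by (intro psubset_card_mono) auto
  qed
  have t: "t j \<in> carrier G" if "j \<in> X" for j using tG that by (simp add: X_def)
  have d\<beta>: "d j = \<beta>" "K j = conj_set G (t j) B" if "j \<in> X" "j \<noteq> \<beta>" for j
  proof -
    have j: "j \<in> I" "b j = \<beta>" using that(1) by (auto simp: X_def)
    then show "d j = \<beta>" using d_b[of j] that(2) by simp
    then show "K j = conj_set G (t j) B" using Kd[OF j(1)] by (simp add: B_def)
  qed
  have c\<beta>: "c \<beta> = 0"
  proof (cases "d \<beta> = \<beta>")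
    \<comment> \<open>The class is a singleton, so the relation has one term, and at
      \<open>t \<beta>\<close> its function takes the nonzero value
      \<open>1 - card B / order G\<close>.\<close>
    case True
    then have "X = {\<beta>}" using d_base[OF \<beta>(1,2)] \<beta> by (auto simp: X_def)
    then have "c \<beta> * of_real (coset_fun G B (t \<beta>) (t \<beta>)) = 0"
      using block[OF t[OF \<beta>(3)]] True by (simp add: B_def)
    moreover have "coset_fun G B (t \<beta>) (t \<beta>) \<noteq> 0"
      using \<kappa> lcos_self[OF t[OF \<beta>(3)] B(1)] by (simp add: coset_fun_def)
    ultimately show ?thesis by simp
  next
    case False
    define L where "L = K (d \<beta>)"
    have L: "maximal_subgroup L G" using max[OF dI[OF \<beta>(1)]] by (simp add: L_def)
    have Ls: "subgroup L G" using L by (simp add: maximal_subgroup_def)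
    show ?thesis
    proof (rule ccontr)
      assume c: "c \<beta> \<noteq> 0"
      let ?g = "t \<beta>"
      have g: "?g \<in> carrier G" using t \<beta>(3) by blast
      \<comment> \<open>Right translation by \<open>k \<in> B\<close> fixes the functions of all
        other members, which are built from left cosets of \<open>B\<close>. If
        \<open>c \<beta> \<noteq> 0\<close>, the function of \<open>\<beta>\<close> must also agree
        at \<open>?g\<close> and \<open>?g \<otimes> k\<close>, so \<open>k \<in> L\<close>. Then
        \<open>B \<subseteq> L\<close>, and maximality forces \<open>L = B\<close>.\<close>
      have "k \<in> L" if k: "k \<in> B" for k
      proof -
        have gk: "?g \<otimes> k \<in> carrier G" using g k by simp
        have same: "coset_fun G (K (d j)) (t j) (?g \<otimes> k) = coset_fun G (K (d j)) (t j) ?g" if j: "j \<in> X - {\<beta>}" for j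
        proof -
          have tj: "t j \<in> carrier G" using t j by blast
          have "inv (t j) \<otimes> (?g \<otimes> k) \<in> B \<longleftrightarrow> inv (t j) \<otimes> ?g \<in> B"
          proof
            assume *: "inv (t j) \<otimes> (?g \<otimes> k) \<in> B"
            have "inv (t j) \<otimes> ?g = inv (t j) \<otimes> (?g \<otimes> k) \<otimes> inv k"
              using tj g k by (simp add: m_assoc)
            also have "\<dots> \<in> B" by (intro B.m_closed * B.m_inv_closed k)
            finally show "inv (t j) \<otimes> ?g \<in> B" .
          next
            assume *: "inv (t j) \<otimes> ?g \<in> B"
            have "inv (t j) \<otimes> (?g \<otimes> k) = inv (t j) \<otimes> ?g \<otimes> k"
              using tj g k by (simp add: m_assoc)
            also have "\<dots> \<in> B" by (intro B.m_closed * k)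
            finally show "inv (t j) \<otimes> (?g \<otimes> k) \<in> B" .
          qed
          then show ?thesis
            using d\<beta>[of j] j by (simp add: coset_fun_def mem_lcoset_iff[OF B(1) tj] gk g B_def[symmetric])
        qed
        have split: "c \<beta> * of_real (coset_fun G L ?g x) + (\<Sum>j\<in>X-{\<beta>}. c j * of_real (coset_fun G (K (d j)) (t j) x)) = 0"
          if "x \<in> carrier G" for x
          using block[OF that] sum.remove[OF finX \<beta>(3), of "\<lambda>j. c j * of_real (coset_fun G (K (d j)) (t j) x)"]
          by (simp add: L_def)
        have "(\<Sum>j\<in>X-{\<beta>}. c j * of_real (coset_fun G (K (d j)) (t j) (?g \<otimes> k)))
          = (\<Sum>j\<in>X-{\<beta>}. c j * of_real (coset_fun G (K (d j)) (t j) ?g))"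
          by (rule sum.cong[OF refl]) (simp only: same)
        then have "c \<beta> * of_real (coset_fun G L ?g (?g \<otimes> k)) = c \<beta> * of_real (coset_fun G L ?g ?g)"
          using split[OF g] split[OF gk] by (metis add_right_cancel)
        then have "coset_fun G L ?g (?g \<otimes> k) = coset_fun G L ?g ?g" using c by simp
        then have "?g \<otimes> k \<in> ?g <# L"
          using lcos_self[OF g Ls] by (simp add: coset_fun_def split: if_splits)
        then have "inv ?g \<otimes> (?g \<otimes> k) \<in> L" using mem_lcoset_iff[OF Ls g] by blast
        then show ?thesis using g k by simp
      qed
      then have "B \<subseteq> L" by blast
      then have "L = B" using max[OF \<beta>(1)] L Ls unfolding B_def maximal_subgroup_def by blast
      then have "d \<beta> = \<beta>" using inj dI[OF \<beta>(1)] \<beta>(1) by (auto simp: inj_on_def L_def B_def)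
      then show False using False by simp
    qed
  qed
  have rest: "(\<Sum>j\<in>X-{\<beta>}. c j * of_real (coset_fun G B (t j) x)) = 0" if x: "x \<in> carrier G" for x
  proof -
    have "(\<Sum>j\<in>X-{\<beta>}. c j * of_real (coset_fun G B (t j) x))
        = (\<Sum>j\<in>X-{\<beta>}. c j * of_real (coset_fun G (K (d j)) (t j) x))"
      using d\<beta> by (intro sum.cong) (auto simp: B_def)
    then show ?thesis
      using block[OF x] sum.remove[OF finX \<beta>(3), of "\<lambda>j. c j * of_real (coset_fun G (K (d j)) (t j) x)"] c\<beta>
      by simp
  qed
  define \<kappa> where "\<kappa> = real (card B) / real (order G)"
  have cf: "coset_fun G B (t j) x = (if x \<in> t j <# B then 1 else 0) - \<kappa>" for j x
    by (simp add: coset_fun_def \<kappa>_def)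
  have "\<kappa> \<noteq> 0" using \<kappa> by (simp add: \<kappa>_def)
  \<comment> \<open>The base itself corresponds to the coset \<open>B\<close>, which the others
    avoid. At \<open>\<one>\<close> only the constants \<open>- \<kappa>\<close> survive, so the
    remaining coefficients sum to zero and the subtracted means cancel everywhere.\<close>
  have "\<one> \<notin> t j <# B" if j: "j \<in> X - {\<beta>}" for j
  proof
    assume "\<one> \<in> t j <# B"
    then have "conj_set G \<one> B = conj_set G (t j) B"
      using conj_set_eq_if_lcoset[OF B(1)] t j by blast
    then have "K j = K \<beta>" using d\<beta>[of j] j conj_set_one[OF B.subset] by (simp add: B_def)
    then show False using inj j \<beta>(1) by (auto simp: inj_on_def X_def)
  qed
  then have "(\<Sum>j\<in>X-{\<beta>}. c j * of_real (coset_fun G B (t j) \<one>)) = (\<Sum>j\<in>X-{\<beta>}. c j * of_real (- \<kappa>))"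
    by (intro sum.cong refl) (simp add: cf)
  also have "\<dots> = - of_real \<kappa> * (\<Sum>j\<in>X-{\<beta>}. c j)"
    by (simp add: sum_distrib_left sum_negf mult_ac)
  finally have sum0: "(\<Sum>j\<in>X-{\<beta>}. c j) = 0"
    using rest[OF one_closed] \<open>\<kappa> \<noteq> 0\<close> by simp
  show ?thesis
  proof (cases "i = \<beta>")
    case True
    then show ?thesis using c\<beta> by simp
  next
    case False
    have ti: "t i \<in> carrier G" using t \<beta>(4) by blast
    \<comment> \<open>Disjointness of the cosets isolates \<open>c i\<close> when the relation is
      evaluated at \<open>t i\<close>.\<close>
    have "t i \<in> t j <# B \<longleftrightarrow> j = i" if j: "j \<in> X - {\<beta>}" for j
    proof
      assume "t i \<in> t j <# B"
      then have "conj_set G (t i) B = conj_set G (t j) B"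
        using conj_set_eq_if_lcoset[OF B(1)] t j by blast
      then have "K j = K i" using d\<beta> j False \<beta>(4) by simp
      then show "j = i" using inj j i by (auto simp: inj_on_def X_def)
    qed (use lcos_self[OF ti B(1)] in simp)
    then have "(\<Sum>j\<in>X-{\<beta>}. c j * of_real (coset_fun G B (t j) (t i)))
      = (\<Sum>j\<in>X-{\<beta>}. (if j = i then c j else 0) - of_real \<kappa> * c j)"
      by (intro sum.cong refl) (auto simp: cf algebra_simps)
    also have "\<dots> = c i - of_real \<kappa> * (\<Sum>j\<in>X-{\<beta>}. c j)"
      using finX \<beta>(4) False by (simp add: sum_subtractf sum_distrib_left)
    finally show ?thesis using rest[OF ti] sum0 by simp
  qed
qed

lemma maximal_coset_choice:
  fixes K :: "nat \<Rightarrow> 'a set"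
  assumes fin: "finite (carrier G)" and solv: "solvable G" and finI: "finite I"
    and max: "\<And>i. i \<in> I \<Longrightarrow> maximal_subgroup (K i) G" and inj: "inj_on K I"
  shows "\<exists>d t. (\<forall>i\<in>I. d i \<in> I \<and> t i \<in> carrier G \<and> K i = conj_set G (t i) (K (d i)))
    \<and> (\<forall>c. (\<forall>x\<in>carrier G. (\<Sum>i\<in>I. c i * complex_of_real (coset_fun G (K (d i)) (t i) x)) = 0)
        \<longrightarrow> (\<forall>i\<in>I. c i = 0))"
proof -
  have sub: "K i \<subseteq> carrier G" if "i \<in> I" for i
    using max[OF that] by (auto simp: maximal_subgroup_def dest: subgroup.subset)
  define rel where "rel i j \<longleftrightarrow> conjugate_sets (K i) (K j)" for i j
  have refl: "rel i i" if "i \<in> I" for i using conjugate_sets_refl[OF sub[OF that]] by (simp add: rel_def)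
  have sym: "rel j i" if "rel i j" "j \<in> I" for i j
    using conjugate_sets_sym[OF sub[OF that(2)]] that(1) by (simp add: rel_def)
  have trans: "rel i k" if "rel i j" "rel j k" for i j k
    using conjugate_sets_trans that unfolding rel_def by blast
  \<comment> \<open>The least index in the class serves as a canonical base, so conjugate members
    get the same one.\<close>
  define b where "b i = (LEAST j. j \<in> I \<and> rel i j)" for i
  have b: "b i \<in> I" "rel i (b i)" if "i \<in> I" for i
    using LeastI[of "\<lambda>j. j \<in> I \<and> rel i j" i] refl[OF that] that by (auto simp: b_def)
  have b_eq: "b i = b j" if "i \<in> I" "j \<in> I" "rel i j" for i j
  proof -
    have "rel i k \<longleftrightarrow> rel j k" for k using that sym trans by blast
    then show ?thesis by (simp add: b_def)
  qed
  have bb: "b (b i) = b i" if "i \<in> I" for i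
    using b_eq[OF that b[OF that]] by simp
  \<comment> \<open>The base takes its coset from some other member of its class and falls back on
    itself only in a singleton class.\<close>
  define d where "d i = (if b i \<noteq> i then b i else if \<exists>j\<in>I. j \<noteq> i \<and> b j = i then SOME j. j \<in> I \<and> j \<noteq> i \<and> b j = i else i)" for i
  have d: "d i \<in> I \<and> rel i (d i)" if i: "i \<in> I" for i
  proof (cases "b i = i \<and> (\<exists>j\<in>I. j \<noteq> i \<and> b j = i)")
    case True
    then have "d i \<in> I \<and> d i \<noteq> i \<and> b (d i) = i"
      using someI_ex[of "\<lambda>j. j \<in> I \<and> j \<noteq> i \<and> b j = i"] by (auto simp: d_def)
    then show ?thesis using b(2)[of "d i"] sym[OF _ i, of "d i"] by auto
  next
    case False
    then show ?thesis using b[OF i] refl[OF i] i by (auto simp: d_def)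
  qed
  have "\<forall>i\<in>I. \<exists>g. g \<in> carrier G \<and> K i = conj_set G g (K (d i))"
    using d unfolding rel_def conjugate_sets_def by blast
  then obtain t where t: "\<forall>i\<in>I. t i \<in> carrier G \<and> K i = conj_set G (t i) (K (d i))"
    by metis
  show ?thesis
  proof (intro exI conjI allI impI ballI)
    fix c i assume zero': "\<forall>x\<in>carrier G. (\<Sum>i\<in>I. c i * complex_of_real (coset_fun G (K (d i)) (t i) x)) = 0"
      and i: "i \<in> I"
    then have zero: "(\<Sum>i\<in>I. c i * complex_of_real (coset_fun G (K (d i)) (t i) x)) = 0" if "x \<in> carrier G" for x
      using that by blast
    show "c i = 0"
    proof (rule coset_fun_independent[where b = b and d = d and t = t and K = K, OF fin finI max inj _ _ _ _ _ zero i])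
      fix j k assume jk: "j \<in> I" "k \<in> I" "b j \<noteq> b k"
      \<comment> \<open>Each \<open>d j\<close> is conjugate to \<open>j\<close>, so a conjugacy
        between \<open>d j\<close> and \<open>d k\<close> would make the bases of \<open>j\<close>
        and \<open>k\<close> equal. Ore's theorem then gives the factorization.\<close>
      then have "\<not> rel (d j) (d k)"
        using d b_eq by metis
      then show "K (d j) <#> K (d k) = carrier G"
        using maximal_conj_or_factorize[OF fin solv max max] d jk unfolding rel_def conjugate_sets_def by blast
    next
      fix j assume j: "j \<in> I" "b j = j" "d j = j"
      have "\<not> (\<exists>k\<in>I. k \<noteq> j \<and> b k = j)"
      proof
        assume ex: "\<exists>k\<in>I. k \<noteq> j \<and> b k = j"
        then have "d j \<noteq> j"
          using someI_ex[of "\<lambda>k. k \<in> I \<and> k \<noteq> j \<and> b k = j"] j(2) by (auto simp: d_def)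
        then show False using j by simp
      qed
      then show "\<forall>k\<in>I. b k = j \<longrightarrow> k = j" by blast
    next
      fix j assume j: "j \<in> I"
      show "b j \<in> I \<and> b (b j) = b j" using b(1)[OF j] bb[OF j] by blast
      show "d j \<in> I \<and> t j \<in> carrier G \<and> K j = conj_set G (t j) (K (d j))"
        using d[OF j] t j by blast
      show "d j = b j" if "b j \<noteq> j" using that by (simp add: d_def)
    qed
  qed (use d t in blast)+
qed

end

subsection \<open>Vectors of the permutation module\<close>

lemma cfun_scale_sum_apply: "(\<Sum>i\<in>I. cfun_scale (c i) (f i)) x = (\<Sum>i\<in>I. c i * f i x)"
  by (induction I rule: infinite_finite_induct) (auto simp: cfun_scale_def)

text \<open>\<open>cfun.independent\<close> speaks about a set and cannot see repetitions, so
  injectivity is derived as well: a repeated vector would give a relation with coefficients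
  \<open>1\<close> and \<open>- 1\<close>.\<close>

lemma cfun_independent_family:
  assumes fin: "finite I"
    and zero: "\<And>c i. (\<Sum>i\<in>I. cfun_scale (c i) (f i)) = 0 \<Longrightarrow> i \<in> I \<Longrightarrow> c i = 0"
  shows "inj_on f I" "cfun.independent (f ` I)"
proof -
  show inj: "inj_on f I"
  proof (rule inj_onI, rule ccontr)
    fix i j assume ij: "i \<in> I" "j \<in> I" "f i = f j" "i \<noteq> j"
    let ?c = "\<lambda>k. if k = i then 1 else if k = j then - 1 else 0 :: complex"
    have "(\<Sum>k\<in>I. cfun_scale (?c k) (f k)) x = 0" for x
    proof -
      have "(\<Sum>k\<in>I. cfun_scale (?c k) (f k)) x = (\<Sum>k\<in>{i, j}. ?c k * f k x)"
        unfolding cfun_scale_sum_apply using fin ij by (intro sum.mono_neutral_right) auto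
      then show ?thesis using ij by simp
    qed
    then have "(\<Sum>k\<in>I. cfun_scale (?c k) (f k)) = 0" by (intro ext) simp
    from zero[OF this ij(1)] show False by simp
  qed
  show "cfun.independent (f ` I)"
  proof (rule cfun.independent_if_scalars_zero)
    show "finite (f ` I)" using fin by simp
    fix u y assume "(\<Sum>v\<in>f ` I. cfun_scale (u v) v) = 0" "y \<in> f ` I"
    then show "u y = 0"
      using zero[of "u \<circ> f"] by (auto simp: sum.reindex[OF inj] o_def)
  qed
qed

context group
begin

lemma lcoset_subset_iff:
  assumes H: "subgroup H G" "H \<subseteq> K" and K: "subgroup K G" and tx: "t \<in> carrier G" "x \<in> carrier G"
  shows "x <# H \<subseteq> t <# K \<longleftrightarrow> x \<in> t <# K"
proof
  show "x <# H \<subseteq> t <# K \<Longrightarrow> x \<in> t <# K" using lcos_self[OF tx(2) H(1)] by blast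
next
  assume "x \<in> t <# K"
  then have "t <# K = x <# K" by (rule l_repr_independence[OF _ tx(1) K])
  then show "x <# H \<subseteq> t <# K" using H(2) unfolding l_coset_def by blast
qed

lemma lcos_in_lcosets: "x \<in> carrier G \<Longrightarrow> x <# H \<in> lcosets H"
  unfolding LCOSETS_def by blast

lemma lcosetsE:
  assumes "C \<in> lcosets H" obtains x where "x \<in> carrier G" "C = x <# H"
  using assms unfolding LCOSETS_def by blast

text \<open>Each coset is hit by \<open>card H\<close> elements. This turns mean zero on
  \<open>G\<close> into weight zero on \<open>G/H\<close>.\<close>

lemma sum_lcosets:
  fixes f :: "'a set \<Rightarrow> complex"
  assumes fin: "finite (carrier G)" and H: "subgroup H G"
  shows "(\<Sum>x\<in>carrier G. f (x <# H)) = of_nat (card H) * (\<Sum>C\<in>lcosets H. f C)"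
proof -
  have img: "(\<lambda>x. x <# H) ` carrier G = lcosets H" unfolding LCOSETS_def by blast
  have "(\<Sum>x\<in>carrier G. f (x <# H)) = (\<Sum>C\<in>lcosets H. \<Sum>x\<in>{x \<in> carrier G. x <# H = C}. f (x <# H))"
    using sum.image_gen[OF fin, of "\<lambda>x. f (x <# H)" "\<lambda>x. x <# H"] by (simp only: img)
  also have "\<dots> = (\<Sum>C\<in>lcosets H. of_nat (card H) * f C)"
  proof (rule sum.cong[OF refl])
    fix C assume "C \<in> lcosets H"
    then obtain y where y: "y \<in> carrier G" "C = y <# H" by (rule lcosetsE)
    have "{x \<in> carrier G. x <# H = C} = C"
    proof (intro equalityI subsetI)
      fix x assume "x \<in> {x \<in> carrier G. x <# H = C}"
      then show "x \<in> C" using lcos_self[OF _ H] by blast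
    next
      fix x assume x: "x \<in> C"
      then have "y <# H = x <# H" using l_repr_independence[OF _ y(1) H] y(2) by blast
      moreover have "x \<in> carrier G" using x y mem_lcoset_iff[OF H y(1)] by blast
      ultimately show "x \<in> {x \<in> carrier G. x <# H = C}" using y(2) by simp
    qed
    then have "(\<Sum>x\<in>{x \<in> carrier G. x <# H = C}. f (x <# H)) = (\<Sum>x\<in>C. f C)"
      by (intro sum.cong) auto
    then show "(\<Sum>x\<in>{x \<in> carrier G. x <# H = C}. f (x <# H)) = of_nat (card H) * f C"
      using card_lcoset[OF H y(1) fin] y(2) by simp
  qed
  finally show ?thesis by (simp add: sum_distrib_left)
qed

text \<open>\<open>coset_fun\<close> pushed down to \<open>G/H\<close>. For
  \<open>H \<subseteq> K\<close> a coset of \<open>H\<close> lies inside \<open>t <# K\<close> or is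
  disjoint from it, so inclusion decides the value.\<close>

definition coset_vector :: "'a set \<Rightarrow> 'a set \<Rightarrow> 'a \<Rightarrow> 'a set \<Rightarrow> complex"
  where "coset_vector H K t C = (if C \<in> lcosets H
    then of_real ((if C \<subseteq> t <# K then 1 else 0) - real (card K) / real (order G)) else 0)"

lemma coset_vector_lcos:
  assumes "subgroup H G" "H \<subseteq> K" "subgroup K G" "t \<in> carrier G" "x \<in> carrier G"
  shows "coset_vector H K t (x <# H) = of_real (coset_fun G K t x)"
  using lcoset_subset_iff[OF assms] lcos_in_lcosets[OF assms(5)]
  by (simp add: coset_vector_def coset_fun_def)

lemma coset_vector_in_perm_module0:
  assumes fin: "finite (carrier G)" and H: "subgroup H G" "H \<subseteq> K" "subgroup K G" and t: "t \<in> carrier G"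
  shows "coset_vector H K t \<in> perm_module0 G H"
proof -
  have "of_nat (card H) * (\<Sum>C\<in>lcosets H. coset_vector H K t C)
      = (\<Sum>x\<in>carrier G. of_real (coset_fun G K t x))"
    unfolding sum_lcosets[OF fin H(1), symmetric]
    by (intro sum.cong refl coset_vector_lcos[OF H t])
  also have "\<dots> = complex_of_real (\<Sum>x\<in>carrier G. coset_fun G K t x)" by simp
  also have "\<dots> = 0" by (simp only: sum_coset_fun[OF fin H(3) t] of_real_0)
  finally have "of_nat (card H) * (\<Sum>C\<in>lcosets H. coset_vector H K t C) = 0" .
  moreover have "card H \<noteq> 0"
  proof -
    have "finite H" using subgroup.subset[OF H(1)] fin finite_subset by blast
    then show ?thesis using subgroup.one_closed[OF H(1)] card_0_eq by blast
  qed
  ultimately show ?thesis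
    by (simp add: perm_module0_def perm_module_def coset_vector_def)
qed

text \<open>Left multiplication by an element of \<open>t K t\<inverse>\<close> maps the coset
  \<open>tK\<close> to itself.\<close>

lemma coset_vector_invariant:
  assumes H: "subgroup H G" "H \<subseteq> K" "subgroup K G" and t: "t \<in> carrier G"
  shows "invariant_under G H (conj_set G t K) (coset_vector H K t)"
  unfolding invariant_under_def
proof (intro ballI ext)
  interpret K: subgroup K G by (rule H(3))
  fix k C assume "k \<in> conj_set G t K"
  then have k: "k \<in> carrier G" "inv t \<otimes> k \<otimes> t \<in> K" by (auto simp: conj_set_def)
  show "perm_act G H k (coset_vector H K t) C = coset_vector H K t C"
  proof (cases "C \<in> lcosets H")
    case True
    then obtain x where x: "x \<in> carrier G" "C = x <# H" by (rule lcosetsE)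
    have kC: "inv k <# C = (inv k \<otimes> x) <# H" using x k subgroup.subset[OF H(1)] by (simp add: lcos_m_assoc)
    have kx: "inv k \<otimes> x \<in> carrier G" using k(1) x(1) by simp
    have "inv t \<otimes> (inv k \<otimes> x) \<in> K \<longleftrightarrow> inv t \<otimes> x \<in> K"
    proof
      assume *: "inv t \<otimes> (inv k \<otimes> x) \<in> K"
      have "inv t \<otimes> x = (inv t \<otimes> k \<otimes> t) \<otimes> (inv t \<otimes> (inv k \<otimes> x))"
        using t k(1) x(1) by (simp add: group_word)
      also have "\<dots> \<in> K" by (intro K.m_closed k(2) *)
      finally show "inv t \<otimes> x \<in> K" .
    next
      assume *: "inv t \<otimes> x \<in> K"
      have "inv t \<otimes> (inv k \<otimes> x) = inv (inv t \<otimes> k \<otimes> t) \<otimes> (inv t \<otimes> x)"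
        using t k(1) x(1) by (simp add: group_word)
      also have "\<dots> \<in> K" by (intro K.m_closed K.m_inv_closed k(2) *)
      finally show "inv t \<otimes> (inv k \<otimes> x) \<in> K" .
    qed
    then have "coset_fun G K t (inv k \<otimes> x) = coset_fun G K t x"
      using x(1) kx by (simp add: coset_fun_def mem_lcoset_iff[OF H(3) t])
    then have "coset_vector H K t (inv k <# C) = coset_vector H K t C"
      unfolding kC unfolding x(2) coset_vector_lcos[OF H t kx] coset_vector_lcos[OF H t x(1)] by simp
    then show ?thesis using True by (simp add: perm_act_def)
  qed (simp add: perm_act_def coset_vector_def)
qed

section \<open>Double cosets and the dimension of the invariants\<close>

lemma mem_double_coset_iff: "y \<in> H <#> {x} <#> H \<longleftrightarrow> (\<exists>h\<in>H. \<exists>h'\<in>H. y = h \<otimes> x \<otimes> h')"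
  unfolding set_mult_def by blast

lemma double_coset_eq:
  assumes H: "subgroup H G" and x: "x \<in> carrier G" and y: "y \<in> H <#> {x} <#> H"
  shows "H <#> {y} <#> H = H <#> {x} <#> H"
proof -
  interpret H: subgroup H G by fact
  obtain h h' where h: "h \<in> H" "h' \<in> H" "y = h \<otimes> x \<otimes> h'"
    using y mem_double_coset_iff by metis
  have hc: "h \<in> carrier G" "h' \<in> carrier G" using h(1,2) H.mem_carrier by blast+
  have xy: "x = inv h \<otimes> y \<otimes> inv h'" unfolding h(3) using hc x by (simp add: group_word)
  show ?thesis
  proof (intro equalityI subsetI)
    fix z assume "z \<in> H <#> {y} <#> H"
    then obtain k k' where k: "k \<in> H" "k' \<in> H" "z = k \<otimes> y \<otimes> k'" using mem_double_coset_iff by metis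
    then have "z = (k \<otimes> h) \<otimes> x \<otimes> (h' \<otimes> k')"
      using hc x unfolding k(3) h(3) by (simp add: m_assoc)
    then show "z \<in> H <#> {x} <#> H" using mem_double_coset_iff k(1,2) h(1,2) H.m_closed by metis
  next
    fix z assume "z \<in> H <#> {x} <#> H"
    then obtain k k' where k: "k \<in> H" "k' \<in> H" "z = k \<otimes> x \<otimes> k'" using mem_double_coset_iff by metis
    have yc: "y \<in> carrier G" unfolding h(3) using hc x by simp
    have "z = (k \<otimes> inv h) \<otimes> y \<otimes> (inv h' \<otimes> k')"
      unfolding k(3) by (subst xy) (use k(1,2) hc yc in \<open>simp add: m_assoc\<close>)
    then show "z \<in> H <#> {y} <#> H"
      using mem_double_coset_iff k(1,2) h(1,2) H.m_closed H.m_inv_closed by metis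
  qed
qed

lemma lcos_subset_double_coset_iff:
  assumes H: "subgroup H G" and x: "x \<in> carrier G" and D: "D \<in> double_cosets G H"
  shows "x <# H \<subseteq> D \<longleftrightarrow> D = H <#> {x} <#> H"
proof
  obtain y where y: "y \<in> carrier G" "D = H <#> {y} <#> H"
    using D unfolding double_cosets_def by blast
  assume "x <# H \<subseteq> D"
  then have "x \<in> D" using lcos_self[OF x H] by blast
  then show "D = H <#> {x} <#> H" using double_coset_eq[OF H y(1)] y(2) by blast
next
  interpret H: subgroup H G by fact
  assume D: "D = H <#> {x} <#> H"
  show "x <# H \<subseteq> D"
  proof
    fix z assume "z \<in> x <# H"
    then obtain h where h: "h \<in> H" "z = x \<otimes> h" by (auto simp: l_coset_def)
    then have "z = \<one> \<otimes> x \<otimes> h" using x by simp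
    then show "z \<in> D" unfolding D mem_double_coset_iff using h(1) H.one_closed by blast
  qed
qed

text \<open>The orbits of \<open>H\<close> on \<open>G/H\<close> are the sets of cosets contained in
  one double coset, and an invariant vector is constant on each orbit.\<close>

lemma invariant_in_span:
  assumes fin: "finite (carrier G)" and H: "subgroup H G"
    and v: "v \<in> perm_module G H" "invariant_under G H H v"
  shows "v \<in> cfun.span ((\<lambda>D C. if C \<in> lcosets H \<and> C \<subseteq> D then 1 else 0) ` double_cosets G H)"
proof -
  interpret H: subgroup H G by fact
  let ?e = "\<lambda>D C. if C \<in> lcosets H \<and> C \<subseteq> D then 1 else 0 :: complex"
  have v_act: "v (h <# C) = v C" if h: "h \<in> H" and C: "C \<in> lcosets H" for h C
  proof -
    have "perm_act G H (inv h) v C = v C"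
      using v(2) H.m_inv_closed[OF h] unfolding invariant_under_def by metis
    then show ?thesis using C H.mem_carrier[OF h] by (simp add: perm_act_def)
  qed
  \<comment> \<open>A representative of each double coset; the value of \<open>v\<close> at its
    coset is the coefficient of that double coset.\<close>
  define r where "r D = (SOME x. x \<in> carrier G \<and> D = H <#> {x} <#> H)" for D
  have r: "r D \<in> carrier G" "D = H <#> {r D} <#> H" if "D \<in> double_cosets G H" for D
  proof -
    have "\<exists>x. x \<in> carrier G \<and> D = H <#> {x} <#> H" using that unfolding double_cosets_def by blast
    from someI_ex[OF this] show "r D \<in> carrier G" "D = H <#> {r D} <#> H" unfolding r_def by blast+
  qed
  have finD: "finite (double_cosets G H)" using fin by (simp add: double_cosets_def)
  have "v C = (\<Sum>D\<in>double_cosets G H. cfun_scale (v (r D <# H)) (?e D)) C" for C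
  proof (cases "C \<in> lcosets H")
    case True
    then obtain x where x: "x \<in> carrier G" "C = x <# H" by (rule lcosetsE)
    let ?D = "H <#> {x} <#> H"
    have D: "?D \<in> double_cosets G H" using x(1) unfolding double_cosets_def by blast
    have "x \<in> H <#> {r ?D} <#> H"
      using lcos_subset_double_coset_iff[OF H x(1) D] lcos_self[OF x(1) H] r(2)[OF D] by blast
    then obtain h h' where h: "h \<in> H" "h' \<in> H" "x = h \<otimes> r ?D \<otimes> h'"
      using mem_double_coset_iff by metis
    have hr: "h \<otimes> r ?D \<in> carrier G" using h(1) r(1)[OF D] by simp
    have "x \<in> (h \<otimes> r ?D) <# H" using h(2,3) unfolding l_coset_def by blast
    then have "(h \<otimes> r ?D) <# H = x <# H" by (rule l_repr_independence[OF _ hr H])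
    moreover have "(h \<otimes> r ?D) <# H = h <# (r ?D <# H)"
      using h(1) r(1)[OF D] by (simp add: lcos_m_assoc H.subset)
    ultimately have vC: "v C = v (r ?D <# H)"
      using v_act[OF h(1) lcos_in_lcosets[OF r(1)[OF D]]] x(2) by simp
    have "(\<Sum>D\<in>double_cosets G H. cfun_scale (v (r D <# H)) (?e D)) C
        = (\<Sum>D\<in>double_cosets G H. if D = ?D then v (r D <# H) else 0)"
      unfolding cfun_scale_sum_apply
    proof (intro sum.cong refl)
      fix D assume "D \<in> double_cosets G H"
      then have "C \<subseteq> D \<longleftrightarrow> D = ?D" using lcos_subset_double_coset_iff[OF H x(1)] x(2) by simp
      then show "v (r D <# H) * ?e D C = (if D = ?D then v (r D <# H) else 0)" using True by simp
    qed
    then show ?thesis using vC finD D by simp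
  next
    case False
    then show ?thesis using v(1) by (simp add: cfun_scale_sum_apply perm_module_def)
  qed
  then have "v = (\<Sum>D\<in>double_cosets G H. cfun_scale (v (r D <# H)) (?e D))" by blast
  also have "\<dots> \<in> cfun.span (?e ` double_cosets G H)"
    by (intro cfun.span_sum cfun.span_scale cfun.span_base imageI)
  finally show ?thesis .
qed

text \<open>The constant vector \<open>e\<close> lies in the span of the double coset indicators but
  outside \<open>V\<close>, so adding it to a basis of \<open>V\<close> keeps independence. This
  accounts for the strict inequality.\<close>

lemma dim_invariants:
  fixes H :: "'a set"
  defines "V \<equiv> {v \<in> perm_module0 G H. invariant_under G H H v}"
  assumes fin: "finite (carrier G)" and H: "subgroup H G"
  shows "cfun.dim V < card (double_cosets G H)"
    and "\<And>S. S \<subseteq> V \<Longrightarrow> cfun.independent S \<Longrightarrow> card S \<le> cfun.dim V"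
proof -
  define W where "W = (\<lambda>D C. if C \<in> lcosets H \<and> C \<subseteq> D then 1 else 0 :: complex) ` double_cosets G H"
  define e where "e = (\<lambda>C. if C \<in> lcosets H then 1 else 0 :: complex)"
  have finW: "finite W" "card W \<le> card (double_cosets G H)"
    using fin by (auto simp: W_def double_cosets_def intro: card_image_le)
  have act: "h <# C \<in> lcosets H" if "h \<in> carrier G" "C \<in> lcosets H" for h C
  proof -
    obtain x where x: "x \<in> carrier G" "C = x <# H" using \<open>C \<in> lcosets H\<close> by (rule lcosetsE)
    then have "h <# C = (h \<otimes> x) <# H" using that(1) subgroup.subset[OF H] by (simp add: lcos_m_assoc)
    then show ?thesis using that(1) x(1) lcos_in_lcosets by simp
  qed
  have "invariant_under G H H e"
    unfolding invariant_under_def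
  proof (intro ballI ext)
    fix h C assume "h \<in> H"
    then have "inv h \<in> carrier G" using subgroup.mem_carrier[OF H] by simp
    then show "perm_act G H h e C = e C" using act by (simp add: perm_act_def e_def)
  qed
  then have eW: "e \<in> cfun.span W"
    unfolding W_def by (intro invariant_in_span[OF fin H]) (simp_all add: e_def perm_module_def)
  have VW: "V \<subseteq> cfun.span W"
    unfolding W_def V_def using invariant_in_span[OF fin H] by (auto simp: perm_module0_def)
  have subV: "cfun.subspace V"
    unfolding cfun.subspace_def V_def perm_module0_def perm_module_def invariant_under_def
    by (auto simp: perm_act_def cfun_scale_def sum.distrib fun_eq_iff simp flip: sum_distrib_left)
  have eV: "e \<notin> V"
  proof
    assume "e \<in> V"
    then have "(\<Sum>C\<in>lcosets H. e C) = 0" by (simp add: V_def perm_module0_def)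
    then have "of_nat (card (lcosets H)) = (0 :: complex)" by (simp add: e_def)
    then have "card (lcosets H) = 0" by simp
    then show False using l_lagrange[OF fin H] order_pos[OF fin] by simp
  qed
  obtain B where B: "B \<subseteq> V" "cfun.independent B" "V \<subseteq> cfun.span B" "card B = cfun.dim V"
    by (rule cfun.basis_exists)
  have "cfun.span B \<subseteq> V" by (rule cfun.span_minimal[OF B(1) subV])
  then have "cfun.independent (insert e B)"
    using B(2) eV by (intro cfun.independent_insertI) auto
  moreover have "insert e B \<subseteq> cfun.span W" using eW VW B(1) by blast
  \<comment> \<open>Finiteness matters here: an infinite \<open>B\<close> would have
    \<open>card B = 0\<close>, and the comparison of cardinalities would say nothing.\<close>
  ultimately have "finite (insert e B) \<and> card (insert e B) \<le> card W"
    by (rule cfun.independent_span_bound[OF finW(1)])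
  moreover have "e \<notin> B" using eV B(1) by blast
  ultimately have finB: "finite B" and "card B < card W" by auto
  then show "cfun.dim V < card (double_cosets G H)" using B(4) finW(2) by simp
  fix S assume S: "S \<subseteq> V" "cfun.independent S"
  then show "card S \<le> cfun.dim V"
    using cfun.independent_span_bound[OF finB S(2)] B(3,4) by auto
qed

end

theorem theorem2p7:
  fixes G :: "('a, 'c) monoid_scheme" (structure)
    and K :: "nat \<Rightarrow> 'a set" and H :: "'a set" and n :: nat
  assumes "group G" and "finite (carrier G)" and "solvable G"
    and "\<And>i. i \<in> {1..n} \<Longrightarrow> maximal_subgroup (K i) G"
    and "inj_on K {1..n}"
    and "H = carrier G \<inter> (\<Inter>i\<in>{1..n}. K i)"
  shows "(\<exists>\<xi> :: nat \<Rightarrow> 'a set \<Rightarrow> complex.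
            (\<forall>i\<in>{1..n}. \<xi> i \<in> perm_module0 G H) \<and>
            inj_on \<xi> {1..n} \<and> cfun.independent (\<xi> ` {1..n}) \<and>
            (\<forall>i\<in>{1..n}. invariant_under G H (K i) (\<xi> i)))
       \<and> n \<le> cfun.dim {v \<in> perm_module0 G H. invariant_under G H H v}
       \<and> cfun.dim {v \<in> perm_module0 G H. invariant_under G H H v} < card (double_cosets G H)"
proof -
  interpret group G by fact
  note fin = assms(2)
  have sub: "subgroup (K i) G" if "i \<in> {1..n}" for i
    using assms(4)[OF that] by (simp add: maximal_subgroup_def)
  have HK: "H \<subseteq> K i" if "i \<in> {1..n}" for i using that assms(6) by blast
  have H: "subgroup H G"
  proof (rule subgroupI)
    show "H \<subseteq> carrier G" using assms(6) by blast
    have "\<one> \<in> H" using assms(6) subgroup.one_closed[OF sub] by blast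
    then show "H \<noteq> {}" by blast
    show "inv a \<in> H" if "a \<in> H" for a
      using that assms(6) subgroup.m_inv_closed[OF sub] by blast
    show "a \<otimes> b \<in> H" if "a \<in> H" "b \<in> H" for a b
      using that assms(6) subgroup.m_closed[OF sub] by blast
  qed
  have "\<exists>d t. (\<forall>i\<in>{1..n}. d i \<in> {1..n} \<and> t i \<in> carrier G \<and> K i = conj_set G (t i) (K (d i)))
    \<and> (\<forall>c. (\<forall>x\<in>carrier G. (\<Sum>i\<in>{1..n}. c i * complex_of_real (coset_fun G (K (d i)) (t i) x)) = 0)
        \<longrightarrow> (\<forall>i\<in>{1..n}. c i = 0))"
    by (rule maximal_coset_choice[OF fin assms(3) finite_atLeastAtMost assms(4,5)])
  then obtain d t where d: "\<forall>i\<in>{1..n}. d i \<in> {1..n} \<and> t i \<in> carrier G \<and> K i = conj_set G (t i) (K (d i))"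
    and indep: "\<forall>c. (\<forall>x\<in>carrier G. (\<Sum>i\<in>{1..n}. c i * complex_of_real (coset_fun G (K (d i)) (t i) x)) = 0)
      \<longrightarrow> (\<forall>i\<in>{1..n}. c i = 0)"
    by (elim exE conjE) (rule that)
  have dI: "d i \<in> {1..n}" and tG: "t i \<in> carrier G" and Kd: "K i = conj_set G (t i) (K (d i))"
    if "i \<in> {1..n}" for i using d that by blast+
  define \<xi> where "\<xi> i = coset_vector H (K (d i)) (t i)" for i
  have mem: "\<xi> i \<in> perm_module0 G H" if "i \<in> {1..n}" for i
    unfolding \<xi>_def using that by (intro coset_vector_in_perm_module0 fin H HK sub dI tG)
  have inv: "invariant_under G H (K i) (\<xi> i)" if "i \<in> {1..n}" for i
    unfolding \<xi>_def by (subst Kd[OF that], rule coset_vector_invariant[OF H HK sub tG]) (use that dI in blast)+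
  \<comment> \<open>Reading a relation between the vectors at the coset \<open>x <# H\<close> gives
    the relation between the coset functions at \<open>x\<close>.\<close>
  have zero: "c i = 0" if "(\<Sum>i\<in>{1..n}. cfun_scale (c i) (\<xi> i)) = 0" "i \<in> {1..n}" for c i
  proof (rule indep[rule_format, OF _ that(2)])
    fix x assume x: "x \<in> carrier G"
    have "(\<Sum>i\<in>{1..n}. c i * complex_of_real (coset_fun G (K (d i)) (t i) x))
        = (\<Sum>i\<in>{1..n}. c i * \<xi> i (x <# H))"
      unfolding \<xi>_def
      by (intro sum.cong refl arg_cong2[where f = "(*)"] coset_vector_lcos[symmetric] H HK sub dI tG x)
    also have "\<dots> = (\<Sum>i\<in>{1..n}. cfun_scale (c i) (\<xi> i)) (x <# H)"
      by (simp only: cfun_scale_sum_apply)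
    finally show "(\<Sum>i\<in>{1..n}. c i * complex_of_real (coset_fun G (K (d i)) (t i) x)) = 0"
      by (simp only: that(1) zero_fun_apply)
  qed
  have ind: "inj_on \<xi> {1..n}" "cfun.independent (\<xi> ` {1..n})"
    by (rule cfun_independent_family[OF finite_atLeastAtMost], fact zero)+
  have "\<xi> i \<in> {v \<in> perm_module0 G H. invariant_under G H H v}" if "i \<in> {1..n}" for i
    using mem[OF that] inv[OF that] HK[OF that] unfolding invariant_under_def by blast
  then have "\<xi> ` {1..n} \<subseteq> {v \<in> perm_module0 G H. invariant_under G H H v}"
    by (rule image_subsetI)
  then have "n \<le> cfun.dim {v \<in> perm_module0 G H. invariant_under G H H v}"
    using dim_invariants(2)[OF fin H _ ind(2)] card_image[OF ind(1)] by simp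
  then show ?thesis
    using mem inv ind dim_invariants(1)[OF fin H] by blast
qed

end
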